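(* Let $\Gamma_g$ be a chain of loops of genus $g\ge1$ and let $H$ be a subgroup of ${\rm Jac}(\Gamma_g)$. Suppose $r,d$ are integers such that $W^r_d(\Gamma_g)\cap H\neq\emptyset$. Then there exist finitely many tropical Abelian subvarieties $A_1,\dots,A_s$ of ${\rm Jac}(\Gamma_g)$ and elements $\gamma_1,\dots,\gamma_s\in H$ such that (i) $\gamma_i+A_i\subseteq W^r_d(\Gamma_g)$ for each $i=1,\dots,s$, and (ii) $W^r_d(\Gamma_g)\cap H=\bigcup_{i=1}^{s}\bigl(\gamma_i+(A_i\cap H)\bigr)$.
   Context: A chain of loops $\Gamma_g$ of genus $g$: for $i=1,\dots,g$, $L_i$ is a circle of length $\ell_i>0$ carrying marked points $w_i$ ($i\le g-1$) and $v_i$ ($i\ge2$), together with a fixed marked point $w_g\in L_g$; for $i=1,\dots,g-1$, $w_i$ is joined to $v_{i+1}$ by a segment of nonnegative length. Divisors, rational functions (continuous piecewise linear with integer slopes), principal divisors (sum of outgoing slopes at each point), linear equivalence and rank $r_{\Gamma_g}$ are the standard ones for metric graphs ($r=-1$ if no effective divisor is linearly equivalent to $D$, otherwise the largest $r$ such that $D-E$ is linearly equivalent to an effective divisor for every effective $E$ of degree $r$). ${\rm Jac}(\Gamma_g)$ is the group of degree-zero divisors modulo principal divisors; it is identified with $V/\Lambda$ where, for a model graph $G$ of $\Gamma_g$, $V=H_1(G,\mathbb{R})$ and $\Lambda=H_1(G,\mathbb{Z})$, with the quadratic form $Q(\sum_e\alpha_e e)=\sum_e\alpha_e^2\ell_e$.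 A tropical Abelian subvariety of ${\rm Jac}(\Gamma_g)$ is a subgroup of the form $V'/\Lambda'$ where $V'\subseteq V$ is a linear subspace and $\Lambda'=\Lambda\cap V'$ is a (saturated) sublattice of full rank in $V'$, equipped with the restriction of $Q$. The Brill–Noether locus is $W^r_d(\Gamma_g)=\{[D]\in{\rm Jac}(\Gamma_g): r_{\Gamma_g}(D+d\cdot(w_g))\ge r\}$. *)

theory Defs
  imports
    "HOL-Analysis.Analysis"
    "HOL-Algebra.Free_Abelian_Groups"
    "Graph_Theory.Digraph"
begin

section \<open>Metric graphs\<close>

text \<open>
  A metric graph is given by a model: a finite oriented multigraph (loops allowed) with an arc
  length function that is positive on the arcs.  The arc \<open>e\<close> is a copy of the closed interval
  from 0 to its length, running from its tail to its head; a point of the metric graph is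
  either a vertex or an interior point of an arc.
\<close>

record ('v, 'e) metric_graph = "('v, 'e) pre_digraph" +
  arc_len :: "'e \<Rightarrow> real"

datatype ('v, 'e) point = Vertex 'v | Inner 'e real

definition points :: "('v, 'e) metric_graph \<Rightarrow> ('v, 'e) point set" where
  "points \<Gamma> = Vertex ` verts \<Gamma> \<union> {Inner e t | e t. e \<in> arcs \<Gamma> \<and> 0 < t \<and> t < arc_len \<Gamma> e}"

definition arc_point :: "('v, 'e) metric_graph \<Rightarrow> 'e \<Rightarrow> real \<Rightarrow> ('v, 'e) point" where
  "arc_point \<Gamma> e t =
     (if t \<le> 0 then Vertex (tail \<Gamma> e)
      else if t < arc_len \<Gamma> e then Inner e t
      else Vertex (head \<Gamma> e))"


subsection \<open>Rational functions and divisors\<close>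

definition integer_piecewise_linear_on :: "real \<Rightarrow> real \<Rightarrow> (real \<Rightarrow> real) \<Rightarrow> bool" where
  "integer_piecewise_linear_on a b \<phi> \<longleftrightarrow>
     continuous_on {a..b} \<phi> \<and>
     (\<exists>S. finite S \<and>
        (\<forall>u v. u < v \<and> {u<..<v} \<subseteq> {a<..<b} - S \<longrightarrow>
           (\<exists>(m::int) c. \<forall>t\<in>{u<..<v}. \<phi> t = of_int m * t + c)))"

definition rational_function :: "('v, 'e) metric_graph \<Rightarrow> (('v, 'e) point \<Rightarrow> real) \<Rightarrow> bool" where
  "rational_function \<Gamma> f \<longleftrightarrow>
     (\<forall>e\<in>arcs \<Gamma>. integer_piecewise_linear_on 0 (arc_len \<Gamma> e) (\<lambda>t. f (arc_point \<Gamma> e t)))"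

text \<open>The slopes at \<open>t\<close> in the two directions pointing away from \<open>t\<close>.\<close>

definition slope_right :: "(real \<Rightarrow> real) \<Rightarrow> real \<Rightarrow> int" where
  "slope_right \<phi> t = (THE m. \<forall>\<^sub>F s in at_right t. \<phi> s = \<phi> t + of_int m * (s - t))"

definition slope_left :: "(real \<Rightarrow> real) \<Rightarrow> real \<Rightarrow> int" where
  "slope_left \<phi> t = (THE m. \<forall>\<^sub>F s in at_left t. \<phi> s = \<phi> t + of_int m * (t - s))"

fun sum_outgoing_slopes ::
  "('v, 'e) metric_graph \<Rightarrow> (('v, 'e) point \<Rightarrow> real) \<Rightarrow> ('v, 'e) point \<Rightarrow> int" where
  "sum_outgoing_slopes \<Gamma> f (Vertex v) =
     (\<Sum>e | e \<in> arcs \<Gamma> \<and> tail \<Gamma> e = v. slope_right (\<lambda>t. f (arc_point \<Gamma> e t)) 0) +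
     (\<Sum>e | e \<in> arcs \<Gamma> \<and> head \<Gamma> e = v. slope_left (\<lambda>t. f (arc_point \<Gamma> e t)) (arc_len \<Gamma> e))"
| "sum_outgoing_slopes \<Gamma> f (Inner e t) =
     slope_right (\<lambda>s. f (arc_point \<Gamma> e s)) t + slope_left (\<lambda>s. f (arc_point \<Gamma> e s)) t"

text \<open>
  Divisors are the elements of the free abelian group on the points, i.e. the finitely supported
  integer-valued functions with support in \<open>points \<Gamma>\<close>.
\<close>

type_synonym ('v, 'e) divisor = "('v, 'e) point \<Rightarrow>\<^sub>0 int"

definition divisors :: "('v, 'e) metric_graph \<Rightarrow> ('v, 'e) divisor set" where
  "divisors \<Gamma> = carrier (free_Abelian_group (points \<Gamma>))"

definition degree :: "('v, 'e) divisor \<Rightarrow> int" where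
  "degree D = (\<Sum>p\<in>Poly_Mapping.keys D. Poly_Mapping.lookup D p)"

definition effective :: "('v, 'e) divisor \<Rightarrow> bool" where
  "effective D \<longleftrightarrow> (\<forall>p. 0 \<le> Poly_Mapping.lookup D p)"

definition principal_divisors :: "('v, 'e) metric_graph \<Rightarrow> ('v, 'e) divisor set" where
  "principal_divisors \<Gamma> =
     {D \<in> divisors \<Gamma>. \<exists>f. rational_function \<Gamma> f \<and>
        (\<forall>p\<in>points \<Gamma>. Poly_Mapping.lookup D p = sum_outgoing_slopes \<Gamma> f p)}"

definition linearly_equivalent ::
  "('v, 'e) metric_graph \<Rightarrow> ('v, 'e) divisor \<Rightarrow> ('v, 'e) divisor \<Rightarrow> bool" where
  "linearly_equivalent \<Gamma> D D' \<longleftrightarrow> D - D' \<in> principal_divisors \<Gamma>"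

definition equiv_to_effective :: "('v, 'e) metric_graph \<Rightarrow> ('v, 'e) divisor \<Rightarrow> bool" where
  "equiv_to_effective \<Gamma> D \<longleftrightarrow> (\<exists>D'\<in>divisors \<Gamma>. effective D' \<and> linearly_equivalent \<Gamma> D D')"

text \<open>
  On a nonempty metric graph the numbers \<open>k\<close> below are bounded by the degree of \<open>D\<close>, so the
  greatest one exists as soon as \<open>D\<close> is equivalent to an effective divisor (\<open>k = 0\<close>).
\<close>

definition divisor_rank :: "('v, 'e) metric_graph \<Rightarrow> ('v, 'e) divisor \<Rightarrow> int" where
  "divisor_rank \<Gamma> D =
     (if equiv_to_effective \<Gamma> D
      then int (GREATEST k. \<forall>E\<in>divisors \<Gamma>. effective E \<and> degree E = int k
                  \<longrightarrow> equiv_to_effective \<Gamma> (D - E))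
      else - 1)"


subsection \<open>The Jacobian and the Brill--Noether loci\<close>

definition degree_zero_group :: "('v, 'e) metric_graph \<Rightarrow> ('v, 'e) divisor monoid" where
  "degree_zero_group \<Gamma> =
     (free_Abelian_group (points \<Gamma>))\<lparr>carrier := {D \<in> divisors \<Gamma>. degree D = 0}\<rparr>"

definition Jac :: "('v, 'e) metric_graph \<Rightarrow> ('v, 'e) divisor set monoid" where
  "Jac \<Gamma> = degree_zero_group \<Gamma> Mod principal_divisors \<Gamma>"

definition divisor_class ::
  "('v, 'e) metric_graph \<Rightarrow> ('v, 'e) divisor \<Rightarrow> ('v, 'e) divisor set" where
  "divisor_class \<Gamma> D = principal_divisors \<Gamma> #>\<^bsub>degree_zero_group \<Gamma>\<^esub> D"

definition brill_noether_locus ::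
  "('v, 'e) metric_graph \<Rightarrow> ('v, 'e) point \<Rightarrow> int \<Rightarrow> int \<Rightarrow> ('v, 'e) divisor set set" where
  "brill_noether_locus \<Gamma> w r d =
     {divisor_class \<Gamma> D | D. D \<in> carrier (degree_zero_group \<Gamma>) \<and>
        r \<le> divisor_rank \<Gamma> (D + frag_cmul d (frag_of w))}"


section \<open>Homology and tropical abelian subvarieties\<close>

text \<open>Finitely supported real functions, as a real vector space.\<close>

instantiation poly_mapping :: (type, real_vector) real_vector
begin

lift_definition scaleR_poly_mapping :: "real \<Rightarrow> ('a \<Rightarrow>\<^sub>0 'b) \<Rightarrow> 'a \<Rightarrow>\<^sub>0 'b"
  is "\<lambda>c f x. c *\<^sub>R f x"
  by (erule finite_subset[rotated]) auto

instance
  by standard (transfer; simp add: scaleR_add_left scaleR_add_right)+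

end

type_synonym 'e chain = "'e \<Rightarrow>\<^sub>0 real"

definition real_chains :: "('v, 'e) metric_graph \<Rightarrow> 'e chain set" where
  "real_chains \<Gamma> = {\<alpha>. Poly_Mapping.keys \<alpha> \<subseteq> arcs \<Gamma>}"

definition integral_chains :: "('v, 'e) metric_graph \<Rightarrow> 'e chain set" where
  "integral_chains \<Gamma> = {\<alpha> \<in> real_chains \<Gamma>. \<forall>e. Poly_Mapping.lookup \<alpha> e \<in> \<int>}"

definition boundary :: "('v, 'e) metric_graph \<Rightarrow> 'e chain \<Rightarrow> 'v \<Rightarrow> real" where
  "boundary \<Gamma> \<alpha> v =
     (\<Sum>e | e \<in> arcs \<Gamma> \<and> head \<Gamma> e = v. Poly_Mapping.lookup \<alpha> e) -
     (\<Sum>e | e \<in> arcs \<Gamma> \<and> tail \<Gamma> e = v. Poly_Mapping.lookup \<alpha> e)"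

definition H1_real :: "('v, 'e) metric_graph \<Rightarrow> 'e chain set" where
  "H1_real \<Gamma> = {\<alpha> \<in> real_chains \<Gamma>. \<forall>v\<in>verts \<Gamma>. boundary \<Gamma> \<alpha> v = 0}"

definition H1_int :: "('v, 'e) metric_graph \<Rightarrow> 'e chain set" where
  "H1_int \<Gamma> = H1_real \<Gamma> \<inter> integral_chains \<Gamma>"

text \<open>The bilinear form of \<open>Q\<close>, i.e. \<open>Q \<alpha> = length_form \<Gamma> \<alpha> \<alpha>\<close>.\<close>

definition length_form :: "('v, 'e) metric_graph \<Rightarrow> 'e chain \<Rightarrow> 'e chain \<Rightarrow> real" where
  "length_form \<Gamma> \<alpha> \<beta> =
     (\<Sum>e\<in>arcs \<Gamma>. Poly_Mapping.lookup \<alpha> e * Poly_Mapping.lookup \<beta> e * arc_len \<Gamma> e)"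

text \<open>
  The Abel--Jacobi map identifying the Jacobian with \<open>V / \<Lambda>\<close>.  A divisor \<open>D\<close> of degree 0 is the
  boundary of an integral 1-chain on the metric graph, which can be taken to be the sum of an
  integral combination \<open>\<alpha>\<close> of arcs and, for each point \<open>p\<close> in the support, \<open>D p\<close> times the
  segment from \<open>foot p\<close> to \<open>p\<close>.  Integrating the harmonic 1-form of \<open>h \<in> V\<close> (constantly \<open>h e\<close> along
  the arc \<open>e\<close>) over the segment from the tail of \<open>e\<close> to \<open>Inner e t\<close> gives \<open>t * h e\<close>, which is the
  pairing of \<open>h\<close> with \<open>t / arc_len e\<close> times \<open>e\<close>.  The image of \<open>D\<close> is the vector \<open>v \<in> V\<close> that
  pairs with all of \<open>V\<close> as this chain does; the choice of \<open>\<alpha>\<close> makes \<open>v\<close> unique only modulo \<open>\<Lambda>\<close>,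
  and \<open>abel_jacobi \<Gamma> D v\<close> states that \<open>v\<close> is one of the representatives.
\<close>

fun foot :: "('v, 'e) metric_graph \<Rightarrow> ('v, 'e) point \<Rightarrow> 'v" where
  "foot \<Gamma> (Vertex v) = v"
| "foot \<Gamma> (Inner e t) = tail \<Gamma> e"

fun segment_chain :: "('v, 'e) metric_graph \<Rightarrow> ('v, 'e) point \<Rightarrow> 'e chain" where
  "segment_chain \<Gamma> (Vertex v) = 0"
| "segment_chain \<Gamma> (Inner e t) = Poly_Mapping.single e (t / arc_len \<Gamma> e)"

definition bounding_chain :: "('v, 'e) metric_graph \<Rightarrow> ('v, 'e) divisor \<Rightarrow> 'e chain \<Rightarrow> bool" where
  "bounding_chain \<Gamma> D c \<longleftrightarrow>
     (\<exists>\<alpha>\<in>integral_chains \<Gamma>.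
        (\<forall>v\<in>verts \<Gamma>. boundary \<Gamma> \<alpha> v =
           of_int (\<Sum>p | p \<in> Poly_Mapping.keys D \<and> foot \<Gamma> p = v. Poly_Mapping.lookup D p)) \<and>
        c = \<alpha> + (\<Sum>p\<in>Poly_Mapping.keys D. of_int (Poly_Mapping.lookup D p) *\<^sub>R segment_chain \<Gamma> p))"

definition abel_jacobi :: "('v, 'e) metric_graph \<Rightarrow> ('v, 'e) divisor \<Rightarrow> 'e chain \<Rightarrow> bool" where
  "abel_jacobi \<Gamma> D v \<longleftrightarrow>
     v \<in> H1_real \<Gamma> \<and>
     (\<exists>c. bounding_chain \<Gamma> D c \<and> (\<forall>h\<in>H1_real \<Gamma>. length_form \<Gamma> v h = length_form \<Gamma> c h))"

text \<open>
  \<open>\<Lambda>' = \<Lambda> \<inter> V'\<close> is automatically discrete and saturated in \<open>\<Lambda>\<close>, so that it is a lattice of full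
  rank in \<open>V'\<close> iff it spans \<open>V'\<close> over the reals.  The form on \<open>V'\<close> is the restriction of
  \<open>length_form\<close>, hence determined by \<open>V'\<close>.
\<close>

definition tropical_abelian_subvariety ::
  "('v, 'e) metric_graph \<Rightarrow> ('v, 'e) divisor set set \<Rightarrow> bool" where
  "tropical_abelian_subvariety \<Gamma> A \<longleftrightarrow>
     (\<exists>V'. V' \<subseteq> H1_real \<Gamma> \<and> subspace V' \<and> span (H1_int \<Gamma> \<inter> V') = V' \<and>
        A = {divisor_class \<Gamma> D | D. D \<in> carrier (degree_zero_group \<Gamma>) \<and>
               (\<exists>v\<in>V'. abel_jacobi \<Gamma> D v)})"


section \<open>Chains of loops\<close>

text \<open>
  The loop \<open>L\<^sub>i\<close> is the circle \<open>\<real> / l i \<int>\<close> with origin \<open>v\<^sub>i\<close> (an arbitrary reference point if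
  \<open>i = 1\<close>) and \<open>w\<^sub>i\<close> at the position \<open>x i \<in> [0, l i)\<close>; the segment from \<open>w\<^sub>i\<close> to \<open>v\<^bsub>i+1\<^esub>\<close> has
  length \<open>b i\<close>.  In the model, \<open>Top i\<close> is the part of \<open>L\<^sub>i\<close> from \<open>v\<^sub>i\<close> to \<open>w\<^sub>i\<close> and \<open>Bottom i\<close> the
  remaining part from \<open>w\<^sub>i\<close> back to \<open>v\<^sub>i\<close>.  Arcs of length 0 are left out and their end points
  are identified: marked points that coincide in the metric graph are given the same name,
  namely that of the first of them in the order v1, w1, v2, w2, ... along the chain.
\<close>

datatype loop_mark = Vmark nat | Wmark nat

datatype loop_arc = Top nat | Bottom nat | Bridge nat

primrec v_vertex :: "(nat \<Rightarrow> real) \<Rightarrow> (nat \<Rightarrow> real) \<Rightarrow> nat \<Rightarrow> loop_mark" where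
  "v_vertex x b 0 = Vmark 0"
| "v_vertex x b (Suc i) =
     (if i = 0 \<or> b i \<noteq> 0 then Vmark (Suc i)
      else if x i \<noteq> 0 then Wmark i
      else v_vertex x b i)"

definition w_vertex :: "(nat \<Rightarrow> real) \<Rightarrow> (nat \<Rightarrow> real) \<Rightarrow> nat \<Rightarrow> loop_mark" where
  "w_vertex x b i = (if x i \<noteq> 0 then Wmark i else v_vertex x b i)"

definition chain_of_loops ::
  "nat \<Rightarrow> (nat \<Rightarrow> real) \<Rightarrow> (nat \<Rightarrow> real) \<Rightarrow> (nat \<Rightarrow> real) \<Rightarrow> (loop_mark, loop_arc) metric_graph" where
  "chain_of_loops g l x b =
     \<lparr> verts = v_vertex x b ` {1..g} \<union> w_vertex x b ` {1..g},
       arcs = {Top i | i. i \<in> {1..g} \<and> x i \<noteq> 0} \<union> Bottom ` {1..g} \<union>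
              {Bridge i | i. i \<in> {1..<g} \<and> b i \<noteq> 0},
       tail = (\<lambda>e. case e of Top i \<Rightarrow> v_vertex x b i
                           | Bottom i \<Rightarrow> w_vertex x b i
                           | Bridge i \<Rightarrow> w_vertex x b i),
       head = (\<lambda>e. case e of Top i \<Rightarrow> w_vertex x b i
                           | Bottom i \<Rightarrow> v_vertex x b i
                           | Bridge i \<Rightarrow> v_vertex x b (Suc i)),
       arc_len = (\<lambda>e. case e of Top i \<Rightarrow> x i
                              | Bottom i \<Rightarrow> l i - x i
                              | Bridge i \<Rightarrow> b i) \<rparr>"


text \<open>This is indeed a model: a finite multigraph with positive arc lengths.\<close>

lemma chain_of_loops_model:
  assumes "\<And>i. i \<in> {1..g} \<Longrightarrow> 0 \<le> x i \<and> x i < l i"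
    and "\<And>i. i \<in> {1..<g} \<Longrightarrow> b i \<ge> 0"
  defines "\<Gamma> \<equiv> chain_of_loops g l x b"
  shows "finite (verts \<Gamma>)" "finite (arcs \<Gamma>)"
    and "e \<in> arcs \<Gamma> \<Longrightarrow> tail \<Gamma> e \<in> verts \<Gamma> \<and> head \<Gamma> e \<in> verts \<Gamma> \<and> arc_len \<Gamma> e > 0"
proof -
  show "finite (verts \<Gamma>)"
    by (simp add: \<Gamma>_def chain_of_loops_def)
  have "arcs \<Gamma> \<subseteq> Top ` {1..g} \<union> Bottom ` {1..g} \<union> Bridge ` {1..g}"
    by (auto simp: \<Gamma>_def chain_of_loops_def)
  then show "finite (arcs \<Gamma>)"
    by (rule finite_subset) auto
  show "tail \<Gamma> e \<in> verts \<Gamma> \<and> head \<Gamma> e \<in> verts \<Gamma> \<and> arc_len \<Gamma> e > 0" if "e \<in> arcs \<Gamma>"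
  proof (cases e)
    case (Top i)
    with that assms(1)[of i] show ?thesis
      by (auto simp: \<Gamma>_def chain_of_loops_def)
  next
    case (Bottom i)
    with that assms(1)[of i] show ?thesis
      by (auto simp: \<Gamma>_def chain_of_loops_def)
  next
    case (Bridge i)
    with that have i: "i \<in> {1..<g}" "b i \<noteq> 0" "Suc i \<in> {1..g}" "i \<in> {1..g}"
      by (auto simp: \<Gamma>_def chain_of_loops_def)
    then have "b i > 0" using assms(2)[of i] by auto
    with i Bridge show ?thesis
      by (simp add: \<Gamma>_def chain_of_loops_def del: v_vertex.simps)
  qed
qed

end

theory Submission
  imports Defs
begin

text \<open>
  The Jacobian is a real torus with one coordinate modulo \<open>\<int>\<close> for each loop, and a point of the
  graph moves only the coordinate of the loop it lies on.  Hence the classes of effective divisors of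
  degree \<open>d\<close>, a \<open>d\<close>-fold Minkowski sum of coordinate circles, form a finite union of cosets of
  coordinate subtori.  The locus \<open>W\<^sup>r\<^sub>d\<close> is an intersection, over all effective divisors of degree \<open>r\<close>,
  of translates of such unions.  Finite unions of cosets of coordinate subtori are stable under
  arbitrary intersections, because a proper intersection of cosets has fewer free coordinates, so
  \<open>W\<^sup>r\<^sub>d\<close> is again a finite union of cosets.  Those meeting \<open>H\<close> can be based at points of \<open>H\<close>.

  The coordinates come from Abel's theorem: the slopes of a rational function are, up to sign, a
  bounding chain of its divisor that is a gradient, hence orthogonal to all cycles; conversely a chain
  orthogonal to all cycles is the gradient of a potential.
\<close>

section \<open>Piecewise linear functions on an interval\<close>

text \<open>The subgroup H need not be closed in the torus, so no topology is available inside it.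
  The whole locus is therefore decomposed first, and H enters only in the last step, through the
  group law. Coordinate i is the period around loop i divided by \<open>l i\<close>. With this
  normalisation the period lattice is Z^g for every choice of lengths; the lengths and the positions
  of the marked points survive only in the base points of the cosets, never in their directions. The
  two halves of Abel's theorem are proved on a general finite metric graph, with the existence of
  potentials left as a hypothesis. For the chain that hypothesis is supplied by integrating from
  loop to loop. Arcs of length 0 are absent from the model and their ends are merged, so a function
  on the vertices must respect these identifications; \<open>vertex_function\<close> checks this
  once for all later potentials. Coordinates are a relation between divisors and real vectors, and
  cosets are handled through their preimages, so that no fundamental domain has to be
  chosen.\<close>

definition kinks :: "real set \<Rightarrow> (real \<Rightarrow> int) \<Rightarrow> real \<Rightarrow> real" where
  "kinks K k s = (\<Sum>t\<in>K. of_int (k t) * max 0 (s - t))"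

lemma slope_right_eqI:
  assumes "\<forall>\<^sub>F s in at_right t. \<phi> s = \<phi> t + of_int m * (s - t)"
  shows "slope_right \<phi> t = m"
  unfolding slope_right_def
proof (rule the_equality)
  fix n :: int
  assume "\<forall>\<^sub>F s in at_right t. \<phi> s = \<phi> t + of_int n * (s - t)"
  with assms eventually_at_right_less[of t]
  have "\<forall>\<^sub>F s in at_right t. n = m"
    by eventually_elim simp
  then show "n = m" by simp
qed (fact assms)

lemma slope_left_eqI:
  assumes "\<forall>\<^sub>F s in at_left t. \<phi> s = \<phi> t + of_int m * (t - s)"
  shows "slope_left \<phi> t = m"
  unfolding slope_left_def
proof (rule the_equality)
  fix n :: int
  have "\<forall>\<^sub>F s in at_left t. s < t"
    by (simp add: eventually_at_filter)
  moreover assume "\<forall>\<^sub>F s in at_left t. \<phi> s = \<phi> t + of_int n * (t - s)"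
  ultimately have "\<forall>\<^sub>F s in at_left t. n = m"
    using assms by eventually_elim simp
  then show "n = m" by simp
qed (fact assms)

text \<open>\<open>c + of_int m * s + kinks K k s\<close> serves as normal form of a piecewise
  linear function, with a change of slope \<open>k u\<close> at each u in K. For s just above t
  exactly the terms with u \<le> t are active, and they are linear in s. The left slope involves u <
  t instead, so for t in K the two outgoing slopes add up to \<open>k t\<close>, the value of the
  divisor there.\<close>

lemma slope_right_kinks:
  assumes K: "finite K" and t: "0 \<le> t" "t < L"
    and \<phi>: "\<And>s. 0 \<le> s \<Longrightarrow> s \<le> L \<Longrightarrow> \<phi> s = c + of_int m * s + kinks K k s"
  shows "slope_right \<phi> t = m + (\<Sum>u | u \<in> K \<and> u \<le> t. k u)"
proof (rule slope_right_eqI)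
  \<comment> \<open>Close enough to t, the point s passes neither L nor the next kink.\<close>
  have "\<forall>\<^sub>F s in at_right t. s < L \<and> (\<forall>u\<in>K. t < u \<longrightarrow> s < u)"
  proof (intro eventually_conj eventually_ball_finite K ballI)
    show "\<forall>\<^sub>F s in at_right t. s < L"
      using t by (intro order_tendstoD(2)[OF tendsto_ident_at])
    show "\<forall>\<^sub>F s in at_right t. t < u \<longrightarrow> s < u" for u
      by (cases "t < u") (auto intro: order_tendstoD(2)[OF tendsto_ident_at])
  qed
  with eventually_at_right_less[of t]
  show "\<forall>\<^sub>F s in at_right t. \<phi> s = \<phi> t + of_int (m + (\<Sum>u | u \<in> K \<and> u \<le> t. k u)) * (s - t)"
  proof eventually_elim
    case (elim s)
    have "kinks K k s = (\<Sum>u\<in>K. of_int (k u) * max 0 (t - u) + (if u \<le> t then of_int (k u) * (s - t) else 0))"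
      unfolding kinks_def using elim by (intro sum.cong) (auto simp: max_def algebra_simps)
    also have "\<dots> = kinks K k t + (\<Sum>u | u \<in> K \<and> u \<le> t. of_int (k u) * (s - t))"
      using K by (simp add: sum.distrib kinks_def sum.inter_filter)
    also have "(\<Sum>u | u \<in> K \<and> u \<le> t. of_int (k u) * (s - t)) = of_int (\<Sum>u | u \<in> K \<and> u \<le> t. k u) * (s - t)"
      by (simp add: sum_distrib_right)
    finally show ?case
      using elim t by (simp add: \<phi> algebra_simps)
  qed
qed

lemma slope_left_kinks:
  assumes K: "finite K" and t: "0 < t" "t \<le> L"
    and \<phi>: "\<And>s. 0 \<le> s \<Longrightarrow> s \<le> L \<Longrightarrow> \<phi> s = c + of_int m * s + kinks K k s"
  shows "slope_left \<phi> t = - (m + (\<Sum>u | u \<in> K \<and> u < t. k u))"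
proof (rule slope_left_eqI)
  have "\<forall>\<^sub>F s in at_left t. 0 < s \<and> s < t \<and> (\<forall>u\<in>K. u < t \<longrightarrow> u < s)"
  proof (intro eventually_conj eventually_ball_finite K ballI)
    show "\<forall>\<^sub>F s in at_left t. s < t"
      by (simp add: eventually_at_filter)
    show "\<forall>\<^sub>F s in at_left t. 0 < s"
      using t by (intro order_tendstoD(1)[OF tendsto_ident_at])
    show "\<forall>\<^sub>F s in at_left t. u < t \<longrightarrow> u < s" for u
      by (cases "u < t") (auto intro: order_tendstoD(1)[OF tendsto_ident_at])
  qed
  then show "\<forall>\<^sub>F s in at_left t. \<phi> s = \<phi> t + of_int (- (m + (\<Sum>u | u \<in> K \<and> u < t. k u))) * (t - s)"
  proof eventually_elim
    case (elim s)
    have "kinks K k t = (\<Sum>u\<in>K. of_int (k u) * max 0 (s - u) + (if u < t then of_int (k u) * (t - s) else 0))"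
      unfolding kinks_def using elim by (intro sum.cong) (auto simp: max_def algebra_simps)
    also have "\<dots> = kinks K k s + (\<Sum>u | u \<in> K \<and> u < t. of_int (k u) * (t - s))"
      using K by (simp add: sum.distrib kinks_def sum.inter_filter)
    also have "(\<Sum>u | u \<in> K \<and> u < t. of_int (k u) * (t - s)) = of_int (\<Sum>u | u \<in> K \<and> u < t. k u) * (t - s)"
      by (simp add: sum_distrib_right)
    finally show ?case
      using elim t by (simp add: \<phi> algebra_simps)
  qed
qed

lemma sum_atMost_eq_sum_lessThan:
  fixes k :: "'a::linorder \<Rightarrow> 'b::comm_monoid_add"
  assumes "finite K"
  shows "(\<Sum>u | u \<in> K \<and> u \<le> t. k u) = (if t \<in> K then k t else 0) + (\<Sum>u | u \<in> K \<and> u < t. k u)"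
proof -
  have "{u \<in> K. u \<le> t} = (if t \<in> K then insert t {u \<in> K. u < t} else {u \<in> K. u < t})"
    by (auto simp: order.order_iff_strict)
  then show ?thesis using assms by simp
qed

text \<open>Piecewise linearity is defined through open intervals; continuity carries the affine
  formula over to the end points.\<close>

lemma affine_on_closed_interval:
  fixes \<phi> :: "real \<Rightarrow> real"
  assumes "a < b" "continuous_on {a..b} \<phi>" "\<And>s. s \<in> {a<..<b} \<Longrightarrow> \<phi> s = m * s + c"
    and "s \<in> {a..b}"
  shows "\<phi> s = m * s + c"
proof -
  have "continuous_on (closure {a<..<b}) (\<lambda>s. \<phi> s - (m * s + c))"
    using assms by (auto intro!: continuous_intros)
  then have "\<phi> s - (m * s + c) = 0"
    by (rule continuous_constant_on_closure) (use assms in auto)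
  then show ?thesis by simp
qed

text \<open>Cut at the last breakpoint t, take the normal form on [0, t], and add one kink at t for
  the change of slope. The kinks stay strictly between 0 and L, where they correspond to inner
  points of an arc.\<close>

lemma integer_piecewise_linear_imp_kinks:
  assumes "integer_piecewise_linear_on 0 L \<phi>" "0 < L"
  shows "\<exists>K k m. finite K \<and> K \<subseteq> {0<..<L} \<and>
           (\<forall>s\<in>{0..L}. \<phi> s = \<phi> 0 + of_int m * s + kinks K k s)"
proof -
  obtain S where cont: "continuous_on {0..L} \<phi>" and S: "finite S"
    and aff: "\<And>u v. u < v \<Longrightarrow> {u<..<v} \<subseteq> {0<..<L} - S \<Longrightarrow>
           \<exists>(m::int) c. \<forall>t\<in>{u<..<v}. \<phi> t = of_int m * t + c"
    using assms(1) unfolding integer_piecewise_linear_on_def by meson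
  \<comment> \<open>The right end is generalised to M, so that the induction hypothesis applies to
    the interval ending at the last breakpoint.\<close>
  have "M \<le> L \<Longrightarrow> \<exists>K k m. finite K \<and> K \<subseteq> {0<..<M} \<and> (\<forall>s\<in>{0..M}. \<phi> s = \<phi> 0 + of_int m * s + kinks K k s)" if "0 < M" for M
    using that
  proof (induction "card (S \<inter> {0<..<M})" arbitrary: M rule: less_induct)
    case less
    show ?case
    proof (cases "S \<inter> {0<..<M} = {}")
      case True
      then obtain m c where mc: "\<forall>t\<in>{0<..<M}. \<phi> t = of_int (m::int) * t + c"
        using aff[of 0 M] less.prems by force
      have "\<phi> s = of_int m * s + c" if "s \<in> {0..M}" for s
        using less.prems mc that
        by - (rule affine_on_closed_interval[of 0 M], auto intro: continuous_on_subset[OF cont])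
      then have "\<forall>s\<in>{0..M}. \<phi> s = c + of_int m * s" "\<phi> 0 = c"
        using less.prems by auto
      then show ?thesis
        by (intro exI[of _ "{}"] exI[of _ "\<lambda>_. 0"] exI[of _ m]) (simp add: kinks_def)
    next
      case False
      define t where "t = Max (S \<inter> {0<..<M})"
      have t: "t \<in> S" "0 < t" "t < M" and tmax: "\<And>u. u \<in> S \<Longrightarrow> 0 < u \<Longrightarrow> u < M \<Longrightarrow> u \<le> t"
        using Max_in[of "S \<inter> {0<..<M}"] S False by (auto simp: t_def)
      have "card (S \<inter> {0<..<t}) < card (S \<inter> {0<..<M})"
        using S t by (intro psubset_card_mono) auto
      then obtain K k m where K: "finite K" "K \<subseteq> {0<..<t}"
        and \<phi>: "\<forall>s\<in>{0..t}. \<phi> s = \<phi> 0 + of_int m * s + kinks K k s"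
        using less.hyps[of t] t less.prems by (meson less_imp_le order_trans)
      obtain n c where nc: "\<forall>s\<in>{t<..<M}. \<phi> s = of_int (n::int) * s + c"
        using aff[of t M] t tmax less.prems by force
      have \<phi>': "\<phi> s = of_int n * s + c" if "s \<in> {t..M}" for s
        using less.prems nc that t
        by - (rule affine_on_closed_interval[of t M], auto intro: continuous_on_subset[OF cont])
      \<comment> \<open>The slope after t is n; the slope just before t is m plus the sum of all
        \<open>k u\<close>.\<close>
      define j where "j = n - m - (\<Sum>u\<in>K. k u)"
      have tK: "t \<notin> K" using K by auto
      have kinks': "kinks (insert t K) (k(t := j)) s = kinks K k s + of_int j * max 0 (s - t)" for s
      proof -
        have "(\<Sum>u\<in>K. of_int ((k(t := j)) u) * max 0 (s - u)) = kinks K k s"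
          unfolding kinks_def using tK by (intro sum.cong) auto
        then show ?thesis using K tK by (simp add: kinks_def)
      qed
      have "\<phi> s = \<phi> 0 + of_int m * s + kinks (insert t K) (k(t := j)) s" if s: "s \<in> {0..M}" for s
      proof (cases "s \<le> t")
        case True
        then show ?thesis using bspec[OF \<phi>, of s] s by (simp add: kinks')
      next
        case False
        have "kinks K k s = kinks K k t + (\<Sum>u\<in>K. of_int (k u) * (s - t))"
          unfolding kinks_def sum.distrib[symmetric]
          using K(2) False by (intro sum.cong) (auto simp: max_def algebra_simps)
        also have "\<dots> = kinks K k t + of_int (\<Sum>u\<in>K. k u) * (s - t)"
          by (simp add: sum_distrib_right)
        finally have "kinks K k s = kinks K k t + of_int (\<Sum>u\<in>K. k u) * (s - t)" .
        moreover have "\<phi> s = \<phi> t + of_int n * (s - t)"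
          using \<phi>'[of s] \<phi>'[of t] s False t by (simp add: algebra_simps)
        ultimately show ?thesis
          using bspec[OF \<phi>, of t] t False unfolding kinks' unfolding j_def by (simp add: algebra_simps)
      qed
      moreover have "finite (insert t K)" "insert t K \<subseteq> {0<..<M}"
        using K t by auto
      ultimately show ?thesis by blast
    qed
  qed
  from this[OF assms(2) order_refl] show ?thesis .
qed

lemma kinks_imp_integer_piecewise_linear:
  assumes K: "finite K"
    and \<phi>: "\<And>s. s \<in> {0..L} \<Longrightarrow> \<phi> s = c + of_int m * s + kinks K k s"
  shows "integer_piecewise_linear_on 0 L \<phi>"
  unfolding integer_piecewise_linear_on_def
proof (intro conjI exI[of _ K] allI impI K)
  have "continuous_on {0..L} (\<lambda>s. c + of_int m * s + kinks K k s)"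
    unfolding kinks_def by (intro continuous_intros)
  then show "continuous_on {0..L} \<phi>"
    by (rule continuous_on_eq) (simp add: \<phi>)
  fix u v :: real
  assume uv: "u < v \<and> {u<..<v} \<subseteq> {0<..<L} - K"
  \<comment> \<open>No kink lies between u and v: those up to u are active on the whole interval,
    the others are still 0. Hence n is the slope there, and \<open>c'\<close> collects the constant
    parts.\<close>
  define n where "n = m + (\<Sum>t | t \<in> K \<and> t \<le> u. k t)"
  define c' where "c' = c - (\<Sum>t | t \<in> K \<and> t \<le> u. of_int (k t) * t)"
  have "\<phi> s = of_int n * s + c'" if s: "s \<in> {u<..<v}" for s
  proof -
    have "kinks K k s = (\<Sum>t\<in>K. if t \<le> u then of_int (k t) * s - of_int (k t) * t else 0)"
      unfolding kinks_def
    proof (rule sum.cong)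
      fix t assume "t \<in> K"
      then have "t \<notin> {u<..<v}" using uv by blast
      then have "t \<le> u \<or> v \<le> t" by auto
      with s show "of_int (k t) * max 0 (s - t) = (if t \<le> u then of_int (k t) * s - of_int (k t) * t else 0)"
        by (auto simp: max_def algebra_simps)
    qed simp
    also have "\<dots> = (\<Sum>t | t \<in> K \<and> t \<le> u. of_int (k t) * s - of_int (k t) * t)"
      using K by (simp add: sum.inter_filter)
    also have "\<dots> = of_int (\<Sum>t | t \<in> K \<and> t \<le> u. k t) * s - (\<Sum>t | t \<in> K \<and> t \<le> u. of_int (k t) * t)"
      by (simp add: sum_subtractf sum_distrib_right)
    finally have "kinks K k s = \<dots>" .
    moreover have "s \<in> {0<..<L}"
      using subsetD[OF conjunct2[OF uv] s] by (rule DiffD1)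
    then have "\<phi> s = c + of_int m * s + kinks K k s"
      by (intro \<phi>) auto
    ultimately show ?thesis
      by (simp add: n_def c'_def algebra_simps)
  qed
  then show "\<exists>(m::int) c. \<forall>t\<in>{u<..<v}. \<phi> t = of_int m * t + c" by blast
qed

section \<open>Divisors and chains\<close>

text \<open>The additive extension of F from points to divisors. The degree, the total coefficient
  over a foot and the sum of the segments are all of this form, so additivity has to be proved only
  once.\<close>

definition divisor_sum :: "('p \<Rightarrow> 'a::real_vector) \<Rightarrow> ('p \<Rightarrow>\<^sub>0 int) \<Rightarrow> 'a" where
  "divisor_sum F D = (\<Sum>p\<in>Poly_Mapping.keys D. of_int (Poly_Mapping.lookup D p) *\<^sub>R F p)"

lemma divisor_sum_superset:
  assumes "finite X" "Poly_Mapping.keys D \<subseteq> X"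
  shows "divisor_sum F D = (\<Sum>p\<in>X. of_int (Poly_Mapping.lookup D p) *\<^sub>R F p)"
  unfolding divisor_sum_def
  using assms by (intro sum.mono_neutral_left) (auto simp: in_keys_iff)

lemma divisor_sum_zero [simp]: "divisor_sum F 0 = 0"
  by (simp add: divisor_sum_def)

lemma divisor_sum_frag_of [simp]: "divisor_sum F (frag_of p) = F p"
  by (simp add: divisor_sum_def)

lemma divisor_sum_add: "divisor_sum F (D + D') = divisor_sum F D + divisor_sum F D'"
  using Poly_Mapping.keys_add[of D D']
  by (simp add: divisor_sum_superset[of "Poly_Mapping.keys D \<union> Poly_Mapping.keys D'"]
      lookup_add scaleR_left_distrib sum.distrib)

lemma divisor_sum_diff: "divisor_sum F (D - D') = divisor_sum F D - divisor_sum F D'"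
  using divisor_sum_add[of F "D - D'" D'] by simp

lemma of_int_degree: "of_int (degree D) = divisor_sum (\<lambda>_. 1::real) D"
  by (simp add: degree_def divisor_sum_def)

lemma degree_zero [simp]: "degree 0 = 0"
  by (simp add: degree_def)

lemma degree_frag_of [simp]: "degree (frag_of p) = 1"
  by (simp add: degree_def)

lemma degree_add: "degree (D + D') = degree D + degree D'"
proof -
  have "real_of_int (degree (D + D')) = of_int (degree D + degree D')"
    by (simp add: of_int_degree divisor_sum_add)
  then show ?thesis by (simp only: of_int_eq_iff)
qed

lemma degree_diff: "degree (D - D') = degree D - degree D'"
  using degree_add[of "D - D'" D'] by simp

lemma degree_frag_cmul: "degree (frag_cmul c D) = c * degree D"
proof (cases "c = 0")
  case False
  then have "Poly_Mapping.keys (frag_cmul c D) = Poly_Mapping.keys D"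
    by auto
  then show ?thesis
    by (simp add: degree_def sum_distrib_left)
qed simp

lemma lookup_scaleR [simp]: "Poly_Mapping.lookup (c *\<^sub>R \<alpha>) e = c *\<^sub>R Poly_Mapping.lookup \<alpha> e"
  by transfer simp

lemma lookup_sum_single:
  assumes "finite X"
  shows "Poly_Mapping.lookup (\<Sum>e\<in>X. Poly_Mapping.single e (F e)) e = (if e \<in> X then F e else 0)"
  using assms by (simp add: lookup_sum lookup_single when_def)

lemma zero_divisor [simp]: "0 \<in> divisors \<Gamma>"
  and add_divisors: "D \<in> divisors \<Gamma> \<Longrightarrow> D' \<in> divisors \<Gamma> \<Longrightarrow> D + D' \<in> divisors \<Gamma>"
  and diff_divisors: "D \<in> divisors \<Gamma> \<Longrightarrow> D' \<in> divisors \<Gamma> \<Longrightarrow> D - D' \<in> divisors \<Gamma>"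
  and frag_cmul_divisors: "D \<in> divisors \<Gamma> \<Longrightarrow> frag_cmul c D \<in> divisors \<Gamma>"
  using Poly_Mapping.keys_add[of D D'] Poly_Mapping.keys_diff[of D D'] keys_cmul[of c D]
  by (auto simp: divisors_def)

lemma frag_of_divisors [simp]: "frag_of p \<in> divisors \<Gamma> \<longleftrightarrow> p \<in> points \<Gamma>"
  by (simp add: divisors_def)

section \<open>Chains, cycles and the length form on a finite metric graph\<close>

locale finite_metric_graph =
  fixes \<Gamma> :: "('v, 'e) metric_graph"
  assumes finite_verts: "finite (verts \<Gamma>)" and finite_arcs: "finite (arcs \<Gamma>)"
    and tail_in_verts: "e \<in> arcs \<Gamma> \<Longrightarrow> tail \<Gamma> e \<in> verts \<Gamma>"
    and head_in_verts: "e \<in> arcs \<Gamma> \<Longrightarrow> head \<Gamma> e \<in> verts \<Gamma>"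
    and arc_len_pos: "e \<in> arcs \<Gamma> \<Longrightarrow> arc_len \<Gamma> e > 0"
begin

lemma boundary_add: "boundary \<Gamma> (\<alpha> + \<beta>) v = boundary \<Gamma> \<alpha> v + boundary \<Gamma> \<beta> v"
  by (simp add: boundary_def lookup_add sum.distrib)

lemma boundary_diff: "boundary \<Gamma> (\<alpha> - \<beta>) v = boundary \<Gamma> \<alpha> v - boundary \<Gamma> \<beta> v"
  by (simp add: boundary_def lookup_minus sum_subtractf)

lemma boundary_scaleR: "boundary \<Gamma> (c *\<^sub>R \<alpha>) v = c * boundary \<Gamma> \<alpha> v"
  by (simp add: boundary_def sum_distrib_left algebra_simps)

lemma boundary_zero [simp]: "boundary \<Gamma> 0 v = 0"
  by (simp add: boundary_def)

lemma boundary_sum: "boundary \<Gamma> (\<Sum>i\<in>I. \<alpha> i) v = (\<Sum>i\<in>I. boundary \<Gamma> (\<alpha> i) v)"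
  by (induction I rule: infinite_finite_induct) (simp_all add: boundary_add)

lemma boundary_single:
  assumes "e \<in> arcs \<Gamma>"
  shows "boundary \<Gamma> (Poly_Mapping.single e c) v =
           (if head \<Gamma> e = v then c else 0) - (if tail \<Gamma> e = v then c else 0)"
  using assms finite_arcs
  by (simp add: boundary_def lookup_single when_def sum.delta)

lemma real_chains_zero [simp]: "0 \<in> real_chains \<Gamma>"
  and real_chains_add: "\<alpha> \<in> real_chains \<Gamma> \<Longrightarrow> \<beta> \<in> real_chains \<Gamma> \<Longrightarrow> \<alpha> + \<beta> \<in> real_chains \<Gamma>"
  and real_chains_diff: "\<alpha> \<in> real_chains \<Gamma> \<Longrightarrow> \<beta> \<in> real_chains \<Gamma> \<Longrightarrow> \<alpha> - \<beta> \<in> real_chains \<Gamma>"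
  using Poly_Mapping.keys_add[of \<alpha> \<beta>] Poly_Mapping.keys_diff[of \<alpha> \<beta>]
  by (auto simp: real_chains_def)

lemma real_chains_scaleR: "\<alpha> \<in> real_chains \<Gamma> \<Longrightarrow> c *\<^sub>R \<alpha> \<in> real_chains \<Gamma>"
  by (auto simp: real_chains_def in_keys_iff)

lemma integral_chains_zero [simp]: "0 \<in> integral_chains \<Gamma>"
  by (simp add: integral_chains_def)

lemma integral_chains_add:
  "\<alpha> \<in> integral_chains \<Gamma> \<Longrightarrow> \<beta> \<in> integral_chains \<Gamma> \<Longrightarrow> \<alpha> + \<beta> \<in> integral_chains \<Gamma>"
  by (simp add: integral_chains_def real_chains_add lookup_add)

lemma integral_chains_diff:
  "\<alpha> \<in> integral_chains \<Gamma> \<Longrightarrow> \<beta> \<in> integral_chains \<Gamma> \<Longrightarrow> \<alpha> - \<beta> \<in> integral_chains \<Gamma>"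
  by (simp add: integral_chains_def real_chains_diff lookup_minus)

lemma integral_chains_scaleR:
  "\<alpha> \<in> integral_chains \<Gamma> \<Longrightarrow> of_int c *\<^sub>R \<alpha> \<in> integral_chains \<Gamma>"
  by (simp add: integral_chains_def real_chains_scaleR)

lemma integral_chains_sum:
  "(\<And>i. i \<in> I \<Longrightarrow> \<alpha> i \<in> integral_chains \<Gamma>) \<Longrightarrow> (\<Sum>i\<in>I. \<alpha> i) \<in> integral_chains \<Gamma>"
  by (induction I rule: infinite_finite_induct) (auto intro: integral_chains_add)

lemma H1_real_zero [simp]: "0 \<in> H1_real \<Gamma>"
  by (simp add: H1_real_def)

lemma H1_real_add: "\<alpha> \<in> H1_real \<Gamma> \<Longrightarrow> \<beta> \<in> H1_real \<Gamma> \<Longrightarrow> \<alpha> + \<beta> \<in> H1_real \<Gamma>"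
  by (simp add: H1_real_def real_chains_add boundary_add)

lemma H1_real_diff: "\<alpha> \<in> H1_real \<Gamma> \<Longrightarrow> \<beta> \<in> H1_real \<Gamma> \<Longrightarrow> \<alpha> - \<beta> \<in> H1_real \<Gamma>"
  by (simp add: H1_real_def real_chains_diff boundary_diff)

lemma H1_real_scaleR: "\<alpha> \<in> H1_real \<Gamma> \<Longrightarrow> c *\<^sub>R \<alpha> \<in> H1_real \<Gamma>"
  by (simp add: H1_real_def real_chains_scaleR boundary_scaleR)

lemma length_form_add: "length_form \<Gamma> (\<alpha> + \<beta>) h = length_form \<Gamma> \<alpha> h + length_form \<Gamma> \<beta> h"
  by (simp add: length_form_def lookup_add sum.distrib algebra_simps)

lemma length_form_diff: "length_form \<Gamma> (\<alpha> - \<beta>) h = length_form \<Gamma> \<alpha> h - length_form \<Gamma> \<beta> h"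
  by (simp add: length_form_def lookup_minus sum_subtractf algebra_simps)

lemma length_form_zero [simp]: "length_form \<Gamma> 0 h = 0"
  by (simp add: length_form_def)

text \<open>A sum of squares weighted by positive lengths. It serves to show that a cycle orthogonal
  to all cycles is 0.\<close>

lemma length_form_definite:
  assumes "\<alpha> \<in> real_chains \<Gamma>" "length_form \<Gamma> \<alpha> \<alpha> = 0"
  shows "\<alpha> = 0"
proof (rule poly_mapping_eqI)
  fix e
  have "\<forall>e\<in>arcs \<Gamma>. Poly_Mapping.lookup \<alpha> e * Poly_Mapping.lookup \<alpha> e * arc_len \<Gamma> e = 0"
    using assms(2) finite_arcs less_imp_le[OF arc_len_pos] unfolding length_form_def
    by (subst (asm) sum_nonneg_eq_0_iff) auto
  then show "Poly_Mapping.lookup \<alpha> e = Poly_Mapping.lookup 0 e"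
    using assms(1) arc_len_pos[of e]
    by (cases "e \<in> arcs \<Gamma>") (auto simp: real_chains_def in_keys_iff subset_iff)
qed

text \<open>Summation by parts: the gradient is adjoint to the boundary. Hence gradients are
  orthogonal to cycles, every boundary has total 0 (constant \<open>pot\<close>), and indicator
  functions as \<open>pot\<close> test a cycle against cuts.\<close>

lemma sum_potential_differences:
  "(\<Sum>e\<in>arcs \<Gamma>. Poly_Mapping.lookup h e * (pot (head \<Gamma> e) - pot (tail \<Gamma> e))) =
     (\<Sum>v\<in>verts \<Gamma>. pot v * boundary \<Gamma> h v)"
proof -
  have *: "(\<Sum>e\<in>arcs \<Gamma>. Poly_Mapping.lookup h e * pot (en e)) =
      (\<Sum>v\<in>verts \<Gamma>. pot v * (\<Sum>e | e \<in> arcs \<Gamma> \<and> en e = v. Poly_Mapping.lookup h e))"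
    if "en ` arcs \<Gamma> \<subseteq> verts \<Gamma>" for en
  proof -
    have "(\<Sum>v\<in>verts \<Gamma>. pot v * (\<Sum>e | e \<in> arcs \<Gamma> \<and> en e = v. Poly_Mapping.lookup h e)) =
        (\<Sum>v\<in>verts \<Gamma>. \<Sum>e | e \<in> arcs \<Gamma> \<and> en e = v. Poly_Mapping.lookup h e * pot (en e))"
      by (intro sum.cong refl) (auto simp: sum_distrib_left intro!: sum.cong)
    also have "\<dots> = (\<Sum>e\<in>arcs \<Gamma>. Poly_Mapping.lookup h e * pot (en e))"
      using finite_arcs finite_verts that by (rule sum.group)
    finally show ?thesis by simp
  qed
  show ?thesis
    using *[of "head \<Gamma>"] *[of "tail \<Gamma>"] head_in_verts tail_in_verts
    by (simp add: boundary_def right_diff_distrib sum_subtractf image_subset_iff)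
qed

section \<open>Sums over a divisor, sorted by vertices and arcs\<close>

definition inner_support :: "('v, 'e) divisor \<Rightarrow> 'e \<Rightarrow> real set" where
  "inner_support D e = {t. Inner e t \<in> Poly_Mapping.keys D}"

lemma finite_inner_support: "finite (inner_support D e)"
proof -
  have "inner_support D e = Inner e -` Poly_Mapping.keys D"
    by (auto simp: inner_support_def)
  then show ?thesis by (simp add: finite_vimageI inj_on_def)
qed

lemma inner_support_subset:
  assumes "D \<in> divisors \<Gamma>" "t \<in> inner_support D e"
  shows "0 < t" "t < arc_len \<Gamma> e"
  using assms by (auto simp: divisors_def points_def inner_support_def)

lemma divisor_sum_points:
  assumes D: "D \<in> divisors \<Gamma>"
  shows "divisor_sum F D =
    (\<Sum>v\<in>verts \<Gamma>. of_int (Poly_Mapping.lookup D (Vertex v)) *\<^sub>R F (Vertex v)) +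
    (\<Sum>e\<in>arcs \<Gamma>. \<Sum>t\<in>inner_support D e. of_int (Poly_Mapping.lookup D (Inner e t)) *\<^sub>R F (Inner e t))"
proof -
  let ?f = "\<lambda>p. of_int (Poly_Mapping.lookup D p) *\<^sub>R F p"
  let ?S = "Sigma (arcs \<Gamma>) (inner_support D)"
  have "Poly_Mapping.keys D \<subseteq> Vertex ` verts \<Gamma> \<union> case_prod Inner ` ?S"
    using D by (force simp: divisors_def points_def inner_support_def)
  then have "divisor_sum F D = (\<Sum>p\<in>Vertex ` verts \<Gamma> \<union> case_prod Inner ` ?S. ?f p)"
    using finite_verts finite_arcs finite_inner_support by (intro divisor_sum_superset) auto
  also have "\<dots> = (\<Sum>p\<in>Vertex ` verts \<Gamma>. ?f p) + (\<Sum>p\<in>case_prod Inner ` ?S. ?f p)"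
    using finite_verts finite_arcs finite_inner_support by (intro sum.union_disjoint) auto
  also have "(\<Sum>p\<in>Vertex ` verts \<Gamma>. ?f p) = (\<Sum>v\<in>verts \<Gamma>. ?f (Vertex v))"
    by (subst sum.reindex) (auto simp: inj_on_def)
  also have "(\<Sum>p\<in>case_prod Inner ` ?S. ?f p) = (\<Sum>(e, t)\<in>?S. ?f (Inner e t))"
    by (subst sum.reindex) (auto simp: inj_on_def case_prod_unfold)
  also have "\<dots> = (\<Sum>e\<in>arcs \<Gamma>. \<Sum>t\<in>inner_support D e. ?f (Inner e t))"
    using finite_arcs finite_inner_support by (subst sum.Sigma) auto
  finally show ?thesis .
qed

text \<open>The foot of an inner point is the tail of its arc, so v also receives everything in the
  interior of the arcs leaving it. The right-hand side is the expression that the slopes of a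
  rational function produce at v.\<close>

lemma divisor_sum_foot:
  assumes "D \<in> divisors \<Gamma>" "v \<in> verts \<Gamma>"
  shows "divisor_sum (\<lambda>p. if foot \<Gamma> p = v then 1 else 0 :: real) D =
    of_int (Poly_Mapping.lookup D (Vertex v) +
      (\<Sum>e | e \<in> arcs \<Gamma> \<and> tail \<Gamma> e = v. \<Sum>t\<in>inner_support D e. Poly_Mapping.lookup D (Inner e t)))"
proof -
  have "(\<Sum>e\<in>arcs \<Gamma>. \<Sum>t\<in>inner_support D e. if tail \<Gamma> e = v then real_of_int (Poly_Mapping.lookup D (Inner e t)) else 0)
     = (\<Sum>e\<in>arcs \<Gamma>. if tail \<Gamma> e = v then \<Sum>t\<in>inner_support D e. real_of_int (Poly_Mapping.lookup D (Inner e t)) else 0)"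
    by (intro sum.cong) auto
  also have "\<dots> = (\<Sum>e | e \<in> arcs \<Gamma> \<and> tail \<Gamma> e = v. \<Sum>t\<in>inner_support D e. real_of_int (Poly_Mapping.lookup D (Inner e t)))"
    using finite_arcs by (simp add: sum.inter_filter)
  finally show ?thesis
    using assms finite_verts by (simp add: divisor_sum_points if_distrib sum.delta cong: if_cong)
qed

lemma lookup_segment_sum:
  assumes "D \<in> divisors \<Gamma>" "e \<in> arcs \<Gamma>"
  shows "Poly_Mapping.lookup (divisor_sum (segment_chain \<Gamma>) D) e =
    (\<Sum>t\<in>inner_support D e. of_int (Poly_Mapping.lookup D (Inner e t)) * t) / arc_len \<Gamma> e"
proof -
  have "Poly_Mapping.lookup (divisor_sum (segment_chain \<Gamma>) D) e =
    (\<Sum>e'\<in>arcs \<Gamma>. \<Sum>t\<in>inner_support D e'.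
       if e' = e then of_int (Poly_Mapping.lookup D (Inner e t)) * t / arc_len \<Gamma> e else 0)"
    unfolding divisor_sum_points[OF assms(1)]
    by (simp add: lookup_add lookup_sum lookup_single when_def if_distrib cong: if_cong)
  also have "\<dots> = (\<Sum>e'\<in>arcs \<Gamma>. if e' = e then
       \<Sum>t\<in>inner_support D e. of_int (Poly_Mapping.lookup D (Inner e t)) * t / arc_len \<Gamma> e else 0)"
    by (intro sum.cong) auto
  also have "\<dots> = (\<Sum>t\<in>inner_support D e. of_int (Poly_Mapping.lookup D (Inner e t)) * t / arc_len \<Gamma> e)"
    using assms(2) finite_arcs by simp
  finally show ?thesis by (simp add: sum_divide_distrib)
qed

section \<open>Bounding chains and the Abel-Jacobi relation\<close>

lemma bounding_chain_iff:
  "bounding_chain \<Gamma> D c \<longleftrightarrow>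
     (\<exists>\<alpha>\<in>integral_chains \<Gamma>.
        (\<forall>v\<in>verts \<Gamma>. boundary \<Gamma> \<alpha> v = divisor_sum (\<lambda>p. if foot \<Gamma> p = v then 1 else 0) D) \<and>
        c = \<alpha> + divisor_sum (segment_chain \<Gamma>) D)"
proof -
  have "of_int (\<Sum>p | p \<in> Poly_Mapping.keys D \<and> foot \<Gamma> p = v. Poly_Mapping.lookup D p) =
      divisor_sum (\<lambda>p. if foot \<Gamma> p = v then 1 else 0 :: real) D" for v
    by (simp add: divisor_sum_def if_distrib sum.inter_filter cong: if_cong)
  then show ?thesis
    unfolding bounding_chain_def divisor_sum_def[of "segment_chain \<Gamma>"] by simp
qed

lemma bounding_chain_add:
  assumes "bounding_chain \<Gamma> D c" "bounding_chain \<Gamma> D' c'"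
  shows "bounding_chain \<Gamma> (D + D') (c + c')"
proof -
  obtain \<alpha> \<alpha>' where "\<alpha> \<in> integral_chains \<Gamma>" "\<alpha>' \<in> integral_chains \<Gamma>"
    and "\<forall>v\<in>verts \<Gamma>. boundary \<Gamma> \<alpha> v = divisor_sum (\<lambda>p. if foot \<Gamma> p = v then 1 else 0) D"
    and "\<forall>v\<in>verts \<Gamma>. boundary \<Gamma> \<alpha>' v = divisor_sum (\<lambda>p. if foot \<Gamma> p = v then 1 else 0) D'"
    and "c = \<alpha> + divisor_sum (segment_chain \<Gamma>) D" "c' = \<alpha>' + divisor_sum (segment_chain \<Gamma>) D'"
    using assms unfolding bounding_chain_iff by blast
  then show ?thesis
    unfolding bounding_chain_iff
    by (intro bexI[of _ "\<alpha> + \<alpha>'"])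
      (simp_all add: integral_chains_add boundary_add divisor_sum_add)
qed

lemma bounding_chain_diff:
  assumes "bounding_chain \<Gamma> D c" "bounding_chain \<Gamma> D' c'"
  shows "bounding_chain \<Gamma> (D - D') (c - c')"
proof -
  obtain \<alpha> \<alpha>' where "\<alpha> \<in> integral_chains \<Gamma>" "\<alpha>' \<in> integral_chains \<Gamma>"
    and "\<forall>v\<in>verts \<Gamma>. boundary \<Gamma> \<alpha> v = divisor_sum (\<lambda>p. if foot \<Gamma> p = v then 1 else 0) D"
    and "\<forall>v\<in>verts \<Gamma>. boundary \<Gamma> \<alpha>' v = divisor_sum (\<lambda>p. if foot \<Gamma> p = v then 1 else 0) D'"
    and "c = \<alpha> + divisor_sum (segment_chain \<Gamma>) D" "c' = \<alpha>' + divisor_sum (segment_chain \<Gamma>) D'"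
    using assms unfolding bounding_chain_iff by blast
  then show ?thesis
    unfolding bounding_chain_iff
    by (intro bexI[of _ "\<alpha> - \<alpha>'"])
      (simp_all add: integral_chains_diff boundary_diff divisor_sum_diff)
qed

lemma abel_jacobi_add:
  "abel_jacobi \<Gamma> D v \<Longrightarrow> abel_jacobi \<Gamma> D' v' \<Longrightarrow> abel_jacobi \<Gamma> (D + D') (v + v')"
  unfolding abel_jacobi_def
  by (metis bounding_chain_add H1_real_add length_form_add)

lemma abel_jacobi_diff:
  "abel_jacobi \<Gamma> D v \<Longrightarrow> abel_jacobi \<Gamma> D' v' \<Longrightarrow> abel_jacobi \<Gamma> (D - D') (v - v')"
  unfolding abel_jacobi_def
  by (metis bounding_chain_diff H1_real_diff length_form_diff)

text \<open>For the zero divisor the segments disappear and the bounding chain is an integral cycle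
  \<alpha>. Then v - \<alpha> is a cycle orthogonal to all cycles, in particular to itself, so v =
  \<alpha>.\<close>

lemma abel_jacobi_zero_iff: "abel_jacobi \<Gamma> 0 v \<longleftrightarrow> v \<in> H1_int \<Gamma>"
proof
  assume "abel_jacobi \<Gamma> 0 v"
  then obtain \<alpha> where v: "v \<in> H1_real \<Gamma>" and \<alpha>: "\<alpha> \<in> integral_chains \<Gamma>"
    "\<forall>v\<in>verts \<Gamma>. boundary \<Gamma> \<alpha> v = 0" "\<forall>h\<in>H1_real \<Gamma>. length_form \<Gamma> v h = length_form \<Gamma> \<alpha> h"
    by (auto simp: abel_jacobi_def bounding_chain_iff)
  then have "\<alpha> \<in> H1_real \<Gamma>" by (simp add: H1_real_def integral_chains_def)
  with v have "v - \<alpha> \<in> H1_real \<Gamma>" by (rule H1_real_diff)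
  with \<alpha>(3) have "length_form \<Gamma> (v - \<alpha>) (v - \<alpha>) = 0" by (simp add: length_form_diff)
  with \<open>v - \<alpha> \<in> H1_real \<Gamma>\<close> have "v - \<alpha> = 0"
    by (intro length_form_definite) (simp_all add: H1_real_def)
  with \<alpha>(1) v show "v \<in> H1_int \<Gamma>" by (simp add: H1_int_def)
next
  assume "v \<in> H1_int \<Gamma>"
  then show "abel_jacobi \<Gamma> 0 v"
    by (auto simp: abel_jacobi_def bounding_chain_iff H1_int_def H1_real_def)
qed

end

section \<open>Abel's theorem\<close>

context finite_metric_graph
begin

text \<open>Here \<open>n e\<close> is the slope of f along e at the head; the slope at the tail is
  \<open>n e\<close> minus the total of D in the interior of e. Integrating the slope over e gives
  the first equation. The second is the value of D at v, rearranged so that the interior of each arc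
  is charged to its tail, in accordance with \<open>foot\<close>.\<close>

lemma rational_function_divisor:
  assumes f: "rational_function \<Gamma> f" and D: "D \<in> divisors \<Gamma>"
    and Df: "\<And>p. p \<in> points \<Gamma> \<Longrightarrow> Poly_Mapping.lookup D p = sum_outgoing_slopes \<Gamma> f p"
  obtains n :: "'e \<Rightarrow> int" where
    "\<And>e. e \<in> arcs \<Gamma> \<Longrightarrow> f (Vertex (head \<Gamma> e)) - f (Vertex (tail \<Gamma> e)) =
        of_int (n e) * arc_len \<Gamma> e - (\<Sum>t\<in>inner_support D e. of_int (Poly_Mapping.lookup D (Inner e t)) * t)"
    "\<And>v. v \<in> verts \<Gamma> \<Longrightarrow> (\<Sum>e | e \<in> arcs \<Gamma> \<and> tail \<Gamma> e = v. n e) - (\<Sum>e | e \<in> arcs \<Gamma> \<and> head \<Gamma> e = v. n e) =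
        Poly_Mapping.lookup D (Vertex v) +
        (\<Sum>e | e \<in> arcs \<Gamma> \<and> tail \<Gamma> e = v. \<Sum>t\<in>inner_support D e. Poly_Mapping.lookup D (Inner e t))"
proof -
  define DI where "DI e = (\<Sum>t\<in>inner_support D e. Poly_Mapping.lookup D (Inner e t))" for e
  have "\<forall>e\<in>arcs \<Gamma>. \<exists>n. f (Vertex (head \<Gamma> e)) - f (Vertex (tail \<Gamma> e)) = of_int n * arc_len \<Gamma> e -
           (\<Sum>t\<in>inner_support D e. of_int (Poly_Mapping.lookup D (Inner e t)) * t) \<and>
         slope_right (\<lambda>t. f (arc_point \<Gamma> e t)) 0 = n - DI e \<and>
         slope_left (\<lambda>t. f (arc_point \<Gamma> e t)) (arc_len \<Gamma> e) = - n"
  proof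
    fix e assume e: "e \<in> arcs \<Gamma>"
    define \<phi> where "\<phi> t = f (arc_point \<Gamma> e t)" for t
    define L where "L = arc_len \<Gamma> e"
    have L: "0 < L" using arc_len_pos[OF e] by (simp add: L_def)
    have "integer_piecewise_linear_on 0 L \<phi>"
      using f e by (simp add: rational_function_def \<phi>_def[abs_def] L_def)
    then obtain K k m where K: "finite K" "K \<subseteq> {0<..<L}"
      and \<phi>: "\<And>s. 0 \<le> s \<Longrightarrow> s \<le> L \<Longrightarrow> \<phi> s = \<phi> 0 + of_int m * s + kinks K k s"
      using integer_piecewise_linear_imp_kinks[OF _ L] by (metis atLeastAtMost_iff)
    have Dt: "Poly_Mapping.lookup D (Inner e t) = (if t \<in> K then k t else 0)" if t: "0 < t" "t < L" for t
    proof -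
      have "Inner e t \<in> points \<Gamma>"
        using e t by (simp add: points_def L_def)
      then have "Poly_Mapping.lookup D (Inner e t) = slope_right \<phi> t + slope_left \<phi> t"
        using Df by (simp add: \<phi>_def[abs_def])
      then show ?thesis
        using sum_atMost_eq_sum_lessThan[OF K(1), of k t] slope_right_kinks[OF K(1) less_imp_le[OF t(1)] t(2) \<phi>]
          slope_left_kinks[OF K(1) t(1) less_imp_le[OF t(2)] \<phi>] by simp
    qed
    \<comment> \<open>K may contain points at which the slope does not change, but there the
      coefficient is 0. This is used for h = 1 (the total of D on the arc) and for h the identity
      (its first moment).\<close>
    have supp: "(\<Sum>t\<in>K. of_int (k t) * h t) = (\<Sum>t\<in>inner_support D e. of_int (Poly_Mapping.lookup D (Inner e t)) * h t)"
      for h :: "real \<Rightarrow> real"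
    proof -
      have "(\<Sum>t\<in>inner_support D e. of_int (Poly_Mapping.lookup D (Inner e t)) * h t) =
        (\<Sum>t\<in>K. of_int (Poly_Mapping.lookup D (Inner e t)) * h t)"
      proof (rule sum.mono_neutral_left[OF K(1)])
        show "inner_support D e \<subseteq> K"
          using inner_support_subset[OF D] Dt by (force simp: inner_support_def in_keys_iff L_def)
      qed (auto simp: inner_support_def in_keys_iff)
      also have "\<dots> = (\<Sum>t\<in>K. of_int (k t) * h t)"
        using Dt K(2) by (intro sum.cong) auto
      finally show ?thesis by simp
    qed
    have "real_of_int (\<Sum>t\<in>K. k t) = of_int (DI e)"
      using supp[of "\<lambda>_. 1"] by (simp add: DI_def)
    then have kDI: "(\<Sum>t\<in>K. k t) = DI e" by (simp only: of_int_eq_iff)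
    have K': "{u \<in> K. u \<le> 0} = {}" "{u \<in> K. u < L} = K"
      using K by auto
    have "slope_right \<phi> 0 = m" "slope_left \<phi> L = - (m + DI e)"
      using slope_right_kinks[OF K(1) order_refl L \<phi>] slope_left_kinks[OF K(1) L order_refl \<phi>]
      by (simp_all add: K' kDI)
    moreover have "kinks K k L = (\<Sum>t\<in>K. of_int (k t) * (L - t))"
      unfolding kinks_def using K(2) by (intro sum.cong) auto
    then have "kinks K k L = of_int (DI e) * L - (\<Sum>t\<in>K. of_int (k t) * t)"
      by (simp add: right_diff_distrib sum_subtractf sum_distrib_right flip: kDI)
    then have "\<phi> L - \<phi> 0 = of_int (m + DI e) * L - (\<Sum>t\<in>K. of_int (k t) * t)"
      using \<phi>[of L] L by (simp add: algebra_simps)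
    moreover have "\<phi> 0 = f (Vertex (tail \<Gamma> e))" "\<phi> L = f (Vertex (head \<Gamma> e))"
      using L by (simp_all add: \<phi>_def arc_point_def L_def)
    ultimately show "\<exists>n. f (Vertex (head \<Gamma> e)) - f (Vertex (tail \<Gamma> e)) = of_int n * arc_len \<Gamma> e -
           (\<Sum>t\<in>inner_support D e. of_int (Poly_Mapping.lookup D (Inner e t)) * t) \<and>
         slope_right (\<lambda>t. f (arc_point \<Gamma> e t)) 0 = n - DI e \<and>
         slope_left (\<lambda>t. f (arc_point \<Gamma> e t)) (arc_len \<Gamma> e) = - n"
      unfolding supp L_def \<phi>_def[abs_def] by (intro exI[of _ "m + DI e"]) simp
  qed
  then obtain n where n': "\<forall>e\<in>arcs \<Gamma>. f (Vertex (head \<Gamma> e)) - f (Vertex (tail \<Gamma> e)) = of_int (n e) * arc_len \<Gamma> e -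
           (\<Sum>t\<in>inner_support D e. of_int (Poly_Mapping.lookup D (Inner e t)) * t) \<and>
         slope_right (\<lambda>t. f (arc_point \<Gamma> e t)) 0 = n e - DI e \<and>
         slope_left (\<lambda>t. f (arc_point \<Gamma> e t)) (arc_len \<Gamma> e) = - n e"
    unfolding bchoice_iff by blast
  then have n: "e \<in> arcs \<Gamma> \<Longrightarrow> f (Vertex (head \<Gamma> e)) - f (Vertex (tail \<Gamma> e)) = of_int (n e) * arc_len \<Gamma> e -
           (\<Sum>t\<in>inner_support D e. of_int (Poly_Mapping.lookup D (Inner e t)) * t)"
      "e \<in> arcs \<Gamma> \<Longrightarrow> slope_right (\<lambda>t. f (arc_point \<Gamma> e t)) 0 = n e - DI e"
      "e \<in> arcs \<Gamma> \<Longrightarrow> slope_left (\<lambda>t. f (arc_point \<Gamma> e t)) (arc_len \<Gamma> e) = - n e" for e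
    by blast+
  show thesis
  proof (rule that[OF n(1)])
    fix v assume "v \<in> verts \<Gamma>"
    then have "Poly_Mapping.lookup D (Vertex v) =
        (\<Sum>e | e \<in> arcs \<Gamma> \<and> tail \<Gamma> e = v. n e - DI e) + (\<Sum>e | e \<in> arcs \<Gamma> \<and> head \<Gamma> e = v. - n e)"
      by (simp add: Df points_def n(2,3))
    then show "(\<Sum>e | e \<in> arcs \<Gamma> \<and> tail \<Gamma> e = v. n e) - (\<Sum>e | e \<in> arcs \<Gamma> \<and> head \<Gamma> e = v. n e) =
        Poly_Mapping.lookup D (Vertex v) +
        (\<Sum>e | e \<in> arcs \<Gamma> \<and> tail \<Gamma> e = v. \<Sum>t\<in>inner_support D e. Poly_Mapping.lookup D (Inner e t))"
      by (simp add: sum_subtractf sum_negf DI_def)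
  qed
qed

text \<open>On each arc f starts at the potential of the tail with the slope dictated by n and bends
  according to D. The hypothesis \<open>pot\<close> says that it then arrives at the potential of
  the head, so f is well defined at the vertices; \<open>flow\<close> gives the correct divisor
  there.\<close>

lemma principal_divisorI:
  assumes D: "D \<in> divisors \<Gamma>"
    and pot: "\<And>e. e \<in> arcs \<Gamma> \<Longrightarrow> pot (head \<Gamma> e) - pot (tail \<Gamma> e) =
        of_int (n e) * arc_len \<Gamma> e - (\<Sum>t\<in>inner_support D e. of_int (Poly_Mapping.lookup D (Inner e t)) * t)"
    and flow: "\<And>v. v \<in> verts \<Gamma> \<Longrightarrow> (\<Sum>e | e \<in> arcs \<Gamma> \<and> tail \<Gamma> e = v. n e) - (\<Sum>e | e \<in> arcs \<Gamma> \<and> head \<Gamma> e = v. n e) =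
        Poly_Mapping.lookup D (Vertex v) +
        (\<Sum>e | e \<in> arcs \<Gamma> \<and> tail \<Gamma> e = v. \<Sum>t\<in>inner_support D e. Poly_Mapping.lookup D (Inner e t))"
  shows "D \<in> principal_divisors \<Gamma>"
proof -
  define DI where "DI e = (\<Sum>t\<in>inner_support D e. Poly_Mapping.lookup D (Inner e t))" for e
  define k where "k e t = Poly_Mapping.lookup D (Inner e t)" for e t
  define f where "f p = (case p of Vertex v \<Rightarrow> pot v
     | Inner e t \<Rightarrow> pot (tail \<Gamma> e) + of_int (n e - DI e) * t + kinks (inner_support D e) (k e) t)" for p
  have f_arc: "f (arc_point \<Gamma> e s) = pot (tail \<Gamma> e) + of_int (n e - DI e) * s + kinks (inner_support D e) (k e) s"
    if e: "e \<in> arcs \<Gamma>" and s: "0 \<le> s" "s \<le> arc_len \<Gamma> e" for e s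
  proof -
    consider "s = 0" | "s = arc_len \<Gamma> e" | "0 < s" "s < arc_len \<Gamma> e" using s by linarith
    then show ?thesis
    proof cases
      case 1
      have "kinks (inner_support D e) (k e) 0 = 0"
        unfolding kinks_def using inner_support_subset(1)[OF D, of _ e] by (intro sum.neutral) (fastforce simp: max_def)
      with 1 show ?thesis by (simp add: f_def arc_point_def)
    next
      case 2
      have "kinks (inner_support D e) (k e) s = (\<Sum>t\<in>inner_support D e. of_int (k e t) * (s - t))"
        unfolding kinks_def using inner_support_subset(2)[OF D, of _ e] 2
        by (intro sum.cong) (auto simp: max_def less_imp_le dest: less_imp_le)
      also have "\<dots> = of_int (DI e) * s - (\<Sum>t\<in>inner_support D e. of_int (k e t) * t)"
        by (simp add: right_diff_distrib sum_subtractf sum_distrib_right DI_def k_def)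
      finally show ?thesis
        using 2 pot[OF e] arc_len_pos[OF e] by (simp add: f_def arc_point_def k_def algebra_simps)
    next
      case 3
      then show ?thesis by (simp add: f_def arc_point_def)
    qed
  qed
  have right: "slope_right (\<lambda>t. f (arc_point \<Gamma> e t)) t = n e - DI e + (\<Sum>u | u \<in> inner_support D e \<and> u \<le> t. k e u)"
    if "e \<in> arcs \<Gamma>" "0 \<le> t" "t < arc_len \<Gamma> e" for e t
    by (rule slope_right_kinks[OF finite_inner_support that(2,3) f_arc[OF that(1)]])
  have left: "slope_left (\<lambda>t. f (arc_point \<Gamma> e t)) t = - (n e - DI e + (\<Sum>u | u \<in> inner_support D e \<and> u < t. k e u))"
    if "e \<in> arcs \<Gamma>" "0 < t" "t \<le> arc_len \<Gamma> e" for e t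
    by (rule slope_left_kinks[OF finite_inner_support that(2,3) f_arc[OF that(1)]])
  have right0: "slope_right (\<lambda>t. f (arc_point \<Gamma> e t)) 0 = n e - DI e" if "e \<in> arcs \<Gamma>" for e
  proof -
    have *: "{u \<in> inner_support D e. u \<le> 0} = {}" using inner_support_subset(1)[OF D] by force
    show ?thesis using right[OF that, of 0] arc_len_pos[OF that] unfolding * by simp
  qed
  have leftL: "slope_left (\<lambda>t. f (arc_point \<Gamma> e t)) (arc_len \<Gamma> e) = - n e" if "e \<in> arcs \<Gamma>" for e
  proof -
    have "{u \<in> inner_support D e. u < arc_len \<Gamma> e} = inner_support D e"
      using inner_support_subset(2)[OF D] by force
    then show ?thesis using left[OF that, of "arc_len \<Gamma> e"] arc_len_pos[OF that] by (simp add: DI_def k_def)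
  qed
  have "rational_function \<Gamma> f"
    unfolding rational_function_def
    by (intro ballI kinks_imp_integer_piecewise_linear[OF finite_inner_support f_arc]) auto
  moreover have "Poly_Mapping.lookup D p = sum_outgoing_slopes \<Gamma> f p" if "p \<in> points \<Gamma>" for p
  proof (cases p)
    case (Vertex v)
    with that have "v \<in> verts \<Gamma>" by (auto simp: points_def)
    from flow[OF this] show ?thesis
      by (simp add: Vertex right0 leftL DI_def sum_subtractf sum_negf)
  next
    case (Inner e t)
    with that have e: "e \<in> arcs \<Gamma>" "0 < t" "t < arc_len \<Gamma> e" by (auto simp: points_def)
    have "k e t = 0" if "t \<notin> inner_support D e"
      using that by (simp add: k_def inner_support_def in_keys_iff)
    then have "(\<Sum>u | u \<in> inner_support D e \<and> u \<le> t. k e u) =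
        k e t + (\<Sum>u | u \<in> inner_support D e \<and> u < t. k e u)"
      by (simp add: sum_atMost_eq_sum_lessThan[OF finite_inner_support])
    then show ?thesis
      using e by (simp add: Inner right left k_def)
  qed
  ultimately show ?thesis
    using D by (auto simp: principal_divisors_def)
qed

lemma principal_imp_abel_jacobi_zero:
  assumes "D \<in> principal_divisors \<Gamma>"
  shows "abel_jacobi \<Gamma> D 0"
proof -
  obtain f where D: "D \<in> divisors \<Gamma>" and f: "rational_function \<Gamma> f"
    "\<And>p. p \<in> points \<Gamma> \<Longrightarrow> Poly_Mapping.lookup D p = sum_outgoing_slopes \<Gamma> f p"
    using assms by (auto simp: principal_divisors_def)
  obtain n where pot: "\<And>e. e \<in> arcs \<Gamma> \<Longrightarrow> f (Vertex (head \<Gamma> e)) - f (Vertex (tail \<Gamma> e)) =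
        of_int (n e) * arc_len \<Gamma> e - (\<Sum>t\<in>inner_support D e. of_int (Poly_Mapping.lookup D (Inner e t)) * t)"
    and flow: "\<And>v. v \<in> verts \<Gamma> \<Longrightarrow> (\<Sum>e | e \<in> arcs \<Gamma> \<and> tail \<Gamma> e = v. n e) - (\<Sum>e | e \<in> arcs \<Gamma> \<and> head \<Gamma> e = v. n e) =
        Poly_Mapping.lookup D (Vertex v) +
        (\<Sum>e | e \<in> arcs \<Gamma> \<and> tail \<Gamma> e = v. \<Sum>t\<in>inner_support D e. Poly_Mapping.lookup D (Inner e t))"
    using rational_function_divisor[OF f(1) D f(2)] by auto
  \<comment> \<open>The sign comes from \<open>boundary\<close>, which counts incoming minus
    outgoing, opposite to outgoing slopes. With it, the coefficient of the bounding chain on e times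
    the length of e is minus the difference of f along e.\<close>
  define \<alpha> where "\<alpha> = (\<Sum>e\<in>arcs \<Gamma>. Poly_Mapping.single e (- real_of_int (n e)))"
  have lookup_\<alpha>: "Poly_Mapping.lookup \<alpha> e = (if e \<in> arcs \<Gamma> then - of_int (n e) else 0)" for e
    by (simp add: \<alpha>_def lookup_sum_single finite_arcs)
  have "\<alpha> \<in> integral_chains \<Gamma>"
    by (auto simp: integral_chains_def real_chains_def in_keys_iff lookup_\<alpha> split: if_splits)
  moreover have "boundary \<Gamma> \<alpha> v = divisor_sum (\<lambda>p. if foot \<Gamma> p = v then 1 else 0) D" if "v \<in> verts \<Gamma>" for v
    unfolding divisor_sum_foot[OF D that] flow[OF that, symmetric]
    by (simp add: boundary_def lookup_\<alpha> sum_negf)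
  moreover have "length_form \<Gamma> (\<alpha> + divisor_sum (segment_chain \<Gamma>) D) h = 0" if h: "h \<in> H1_real \<Gamma>" for h
  proof -
    have "length_form \<Gamma> (\<alpha> + divisor_sum (segment_chain \<Gamma>) D) h =
        - (\<Sum>e\<in>arcs \<Gamma>. Poly_Mapping.lookup h e * (f (Vertex (head \<Gamma> e)) - f (Vertex (tail \<Gamma> e))))"
      unfolding length_form_def sum_negf[symmetric]
    proof (rule sum.cong)
      fix e assume e: "e \<in> arcs \<Gamma>"
      then have "(\<Sum>t\<in>inner_support D e. of_int (Poly_Mapping.lookup D (Inner e t)) * t) =
        Poly_Mapping.lookup (divisor_sum (segment_chain \<Gamma>) D) e * arc_len \<Gamma> e"
        using arc_len_pos[OF e] by (simp add: lookup_segment_sum[OF D])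
      with e show "Poly_Mapping.lookup (\<alpha> + divisor_sum (segment_chain \<Gamma>) D) e * Poly_Mapping.lookup h e * arc_len \<Gamma> e =
         - (Poly_Mapping.lookup h e * (f (Vertex (head \<Gamma> e)) - f (Vertex (tail \<Gamma> e))))"
        unfolding pot[OF e] by (simp add: lookup_add lookup_\<alpha> algebra_simps)
    qed simp
    also have "\<dots> = - (\<Sum>v\<in>verts \<Gamma>. f (Vertex v) * boundary \<Gamma> h v)"
      using sum_potential_differences[of h "\<lambda>v. f (Vertex v)"] by simp
    also have "\<dots> = 0"
      using h by (simp add: H1_real_def)
    finally show ?thesis .
  qed
  ultimately show ?thesis
    by (auto simp: abel_jacobi_def bounding_chain_iff)
qed

text \<open>The hypothesis \<open>potential\<close> says that a function on the arcs orthogonal to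
  all cycles is a gradient; \<open>cycle_potential\<close> provides it for chains of loops.\<close>

lemma abel_jacobi_zero_imp_principal:
  assumes D: "D \<in> divisors \<Gamma>" and AJ: "abel_jacobi \<Gamma> D 0"
    and potential: "\<And>y. (\<And>h. h \<in> H1_real \<Gamma> \<Longrightarrow> (\<Sum>e\<in>arcs \<Gamma>. Poly_Mapping.lookup h e * y e) = 0) \<Longrightarrow>
       \<exists>pot. \<forall>e\<in>arcs \<Gamma>. pot (head \<Gamma> e) - pot (tail \<Gamma> e) = y e"
  shows "D \<in> principal_divisors \<Gamma>"
proof -
  obtain \<alpha> where \<alpha>: "\<alpha> \<in> integral_chains \<Gamma>"
    and bd: "\<And>v. v \<in> verts \<Gamma> \<Longrightarrow> boundary \<Gamma> \<alpha> v = divisor_sum (\<lambda>p. if foot \<Gamma> p = v then 1 else 0) D"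
    and orth: "\<And>h. h \<in> H1_real \<Gamma> \<Longrightarrow> length_form \<Gamma> (\<alpha> + divisor_sum (segment_chain \<Gamma>) D) h = 0"
    using AJ by (auto simp: abel_jacobi_def bounding_chain_iff)
  define n where "n e = - \<lfloor>Poly_Mapping.lookup \<alpha> e\<rfloor>" for e
  have n: "Poly_Mapping.lookup \<alpha> e = - of_int (n e)" for e
    using \<alpha> by (simp add: n_def integral_chains_def of_int_floor)
  \<comment> \<open>The increase along e of a function with slope \<open>n e\<close> at the head and
    divisor D inside e. Orthogonality of the bounding chain to cycles is orthogonality of y to
    cycles.\<close>
  define y where "y e = of_int (n e) * arc_len \<Gamma> e -
    (\<Sum>t\<in>inner_support D e. of_int (Poly_Mapping.lookup D (Inner e t)) * t)" for e
  have "(\<Sum>e\<in>arcs \<Gamma>. Poly_Mapping.lookup h e * y e) = 0" if "h \<in> H1_real \<Gamma>" for h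
  proof -
    have "(\<Sum>e\<in>arcs \<Gamma>. Poly_Mapping.lookup h e * y e) =
      - length_form \<Gamma> (\<alpha> + divisor_sum (segment_chain \<Gamma>) D) h"
      unfolding length_form_def sum_negf[symmetric]
    proof (rule sum.cong)
      fix e assume e: "e \<in> arcs \<Gamma>"
      then have *: "(\<Sum>t\<in>inner_support D e. of_int (Poly_Mapping.lookup D (Inner e t)) * t) =
        Poly_Mapping.lookup (divisor_sum (segment_chain \<Gamma>) D) e * arc_len \<Gamma> e"
        using arc_len_pos[OF e] by (simp add: lookup_segment_sum[OF D])
      show "Poly_Mapping.lookup h e * y e =
         - (Poly_Mapping.lookup (\<alpha> + divisor_sum (segment_chain \<Gamma>) D) e * Poly_Mapping.lookup h e * arc_len \<Gamma> e)"
        unfolding y_def * by (simp add: lookup_add n algebra_simps)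
    qed simp
    with orth[OF that] show ?thesis by simp
  qed
  then obtain pot where "\<forall>e\<in>arcs \<Gamma>. pot (head \<Gamma> e) - pot (tail \<Gamma> e) = y e"
    using potential by blast
  moreover have "(\<Sum>e | e \<in> arcs \<Gamma> \<and> tail \<Gamma> e = v. n e) - (\<Sum>e | e \<in> arcs \<Gamma> \<and> head \<Gamma> e = v. n e) =
        Poly_Mapping.lookup D (Vertex v) +
        (\<Sum>e | e \<in> arcs \<Gamma> \<and> tail \<Gamma> e = v. \<Sum>t\<in>inner_support D e. Poly_Mapping.lookup D (Inner e t))"
    if "v \<in> verts \<Gamma>" for v
  proof -
    have "real_of_int ((\<Sum>e | e \<in> arcs \<Gamma> \<and> tail \<Gamma> e = v. n e) - (\<Sum>e | e \<in> arcs \<Gamma> \<and> head \<Gamma> e = v. n e)) =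
      boundary \<Gamma> \<alpha> v"
      by (simp add: boundary_def n sum_negf)
    then show ?thesis
      unfolding bd[OF that] divisor_sum_foot[OF D that] by (simp only: of_int_eq_iff)
  qed
  ultimately show ?thesis
    using D by (intro principal_divisorI[of D pot n]) (auto simp: y_def)
qed

end

text \<open>Every point of D is counted at exactly one foot, so the degree is the total of a
  boundary.\<close>

lemma (in finite_metric_graph) bounding_chain_imp_degree_zero:
  assumes D: "D \<in> divisors \<Gamma>" and "bounding_chain \<Gamma> D c"
  shows "degree D = 0"
proof -
  obtain \<alpha> where \<alpha>: "\<And>v. v \<in> verts \<Gamma> \<Longrightarrow> boundary \<Gamma> \<alpha> v = divisor_sum (\<lambda>p. if foot \<Gamma> p = v then 1 else 0) D"
    using assms(2) by (auto simp: bounding_chain_iff)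
  have foot: "foot \<Gamma> p \<in> verts \<Gamma>" if "p \<in> Poly_Mapping.keys D" for p
    using D that tail_in_verts by (auto simp: divisors_def points_def)
  have "real_of_int (degree D) = divisor_sum (\<lambda>p. \<Sum>v\<in>verts \<Gamma>. if foot \<Gamma> p = v then 1 else 0 :: real) D"
    unfolding of_int_degree divisor_sum_def using foot finite_verts by (intro sum.cong) auto
  also have "\<dots> = (\<Sum>v\<in>verts \<Gamma>. boundary \<Gamma> \<alpha> v)"
    unfolding divisor_sum_def scaleR_sum_right by (subst sum.swap) (simp add: \<alpha> divisor_sum_def)
  also have "\<dots> = 0"
    using sum_potential_differences[of \<alpha> "\<lambda>_. 1"] by simp
  finally show ?thesis by simp
qed

section \<open>Coordinates on the Jacobian of a chain of loops\<close>

text \<open>Unfolding would turn \<open>vv (Suc i)\<close>, the head of a bridge, into a case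
  distinction on zero lengths and hide it from the facts stated about \<open>vv\<close>.\<close>

declare v_vertex.simps(2) [simp del]

locale loop_chain =
  fixes g :: nat and l x b :: "nat \<Rightarrow> real"
  assumes genus: "g \<ge> 1"
    and marked_points: "\<And>i. i \<in> {1..g} \<Longrightarrow> 0 \<le> x i \<and> x i < l i"
    and bridge_lengths: "\<And>i. i \<in> {1..<g} \<Longrightarrow> b i \<ge> 0"
begin

abbreviation "\<Gamma> \<equiv> chain_of_loops g l x b"
abbreviation "vv \<equiv> v_vertex x b"
abbreviation "ww \<equiv> w_vertex x b"

sublocale finite_metric_graph \<Gamma>
  using chain_of_loops_model[of g x l b] marked_points bridge_lengths
  by unfold_locales blast+

lemma len_pos: "i \<in> {1..g} \<Longrightarrow> l i > 0"
  using marked_points by force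

lemma verts_chain: "verts \<Gamma> = vv ` {1..g} \<union> ww ` {1..g}"
  by (simp add: chain_of_loops_def)

lemma arcs_chain [simp]:
  "Top i \<in> arcs \<Gamma> \<longleftrightarrow> i \<in> {1..g} \<and> x i \<noteq> 0"
  "Bottom i \<in> arcs \<Gamma> \<longleftrightarrow> i \<in> {1..g}"
  "Bridge i \<in> arcs \<Gamma> \<longleftrightarrow> i \<in> {1..<g} \<and> b i \<noteq> 0"
  by (auto simp: chain_of_loops_def)

lemma ends_chain [simp]:
  "tail \<Gamma> (Top i) = vv i" "tail \<Gamma> (Bottom i) = ww i" "tail \<Gamma> (Bridge i) = ww i"
  "head \<Gamma> (Top i) = ww i" "head \<Gamma> (Bottom i) = vv i" "head \<Gamma> (Bridge i) = vv (Suc i)"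
  by (simp_all add: chain_of_loops_def)

lemma arc_len_chain [simp]:
  "arc_len \<Gamma> (Top i) = x i" "arc_len \<Gamma> (Bottom i) = l i - x i" "arc_len \<Gamma> (Bridge i) = b i"
  by (simp_all add: chain_of_loops_def)

lemma sum_arcs:
  "(\<Sum>e\<in>arcs \<Gamma>. F e) = (\<Sum>i=1..g. (if x i \<noteq> 0 then F (Top i) else 0) + F (Bottom i)) +
     (\<Sum>i=1..<g. if b i \<noteq> 0 then F (Bridge i) else 0)"
proof -
  have arcs: "arcs \<Gamma> = (Top ` {i \<in> {1..g}. x i \<noteq> 0} \<union> Bottom ` {1..g}) \<union> Bridge ` {i \<in> {1..<g}. b i \<noteq> 0}"
    by (auto simp: chain_of_loops_def)
  have "(\<Sum>e\<in>arcs \<Gamma>. F e) = ((\<Sum>i | i \<in> {1..g} \<and> x i \<noteq> 0. F (Top i)) + (\<Sum>i\<in>{1..g}. F (Bottom i))) +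
      (\<Sum>i | i \<in> {1..<g} \<and> b i \<noteq> 0. F (Bridge i))"
    unfolding arcs by (subst sum.union_disjoint; (subst sum.union_disjoint)?) (auto simp: sum.reindex inj_on_def)
  then show ?thesis
    by (simp only: sum.distrib sum.inter_filter[OF finite_atLeastAtMost] sum.inter_filter[OF finite_atLeastLessThan])
qed

text \<open>The assumptions are the compatibility conditions for merged marked points. The potential
  is defined on names, and the induction follows a merged point back along the chain to the first
  mark, which names it.\<close>

lemma vertex_function:
  assumes "\<And>j. x j = 0 \<Longrightarrow> fw j = fv j" "\<And>j. b j = 0 \<Longrightarrow> fv (Suc j) = fw j"
  obtains pot where "\<And>j. j \<ge> 1 \<Longrightarrow> pot (vv j) = fv j" "\<And>j. j \<ge> 1 \<Longrightarrow> pot (ww j) = fw j"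
proof -
  define pot where "pot m = (case m of Vmark j \<Rightarrow> fv j | Wmark j \<Rightarrow> fw j)" for m
  have v: "pot (vv j) = fv j" if "j \<ge> 1" for j
    using that
  proof (induction j)
    case (Suc j)
    with assms[of j] show ?case by (auto simp: pot_def v_vertex.simps(2))
  qed simp
  then have "pot (ww j) = fw j" if "j \<ge> 1" for j
    using that assms(1)[of j] by (simp add: w_vertex_def pot_def)
  with v show thesis by (rule that)
qed

section \<open>The homology of the chain, with the loops as basis\<close>

definition loop :: "nat \<Rightarrow> loop_arc chain" where
  "loop i = (if x i \<noteq> 0 then Poly_Mapping.single (Top i) 1 else 0) + Poly_Mapping.single (Bottom i) 1"

text \<open>Linear parametrisation of the homology by R^g. Values of a outside {1..g} are
  ignored.\<close>

definition cycle :: "(nat \<Rightarrow> real) \<Rightarrow> loop_arc chain" where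
  "cycle a = (\<Sum>i=1..g. a i *\<^sub>R loop i)"

lemma lookup_cycle:
  "Poly_Mapping.lookup (cycle a) (Top i) = (if i \<in> {1..g} \<and> x i \<noteq> 0 then a i else 0)"
  "Poly_Mapping.lookup (cycle a) (Bottom i) = (if i \<in> {1..g} then a i else 0)"
  "Poly_Mapping.lookup (cycle a) (Bridge i) = 0"
proof -
  have "Poly_Mapping.lookup (cycle a) (Top i) = (\<Sum>j=1..g. if j = i then (if x i \<noteq> 0 then a i else 0) else 0)"
    unfolding cycle_def lookup_sum by (intro sum.cong) (auto simp: loop_def lookup_add lookup_single when_def)
  then show "Poly_Mapping.lookup (cycle a) (Top i) = (if i \<in> {1..g} \<and> x i \<noteq> 0 then a i else 0)"
    by simp
  have "Poly_Mapping.lookup (cycle a) (Bottom i) = (\<Sum>j=1..g. if j = i then a i else 0)"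
    unfolding cycle_def lookup_sum by (intro sum.cong) (auto simp: loop_def lookup_add lookup_single when_def)
  then show "Poly_Mapping.lookup (cycle a) (Bottom i) = (if i \<in> {1..g} then a i else 0)"
    by simp
  show "Poly_Mapping.lookup (cycle a) (Bridge i) = 0"
    unfolding cycle_def lookup_sum by (intro sum.neutral) (auto simp: loop_def lookup_add lookup_single when_def)
qed

lemma cycle_add: "cycle a + cycle a' = cycle (\<lambda>i. a i + a' i)"
  by (simp add: cycle_def scaleR_left_distrib sum.distrib)

lemma cycle_diff: "cycle a - cycle a' = cycle (\<lambda>i. a i - a' i)"
  by (simp add: cycle_def scaleR_left_diff_distrib sum_subtractf)

lemma cycle_scaleR: "c *\<^sub>R cycle a = cycle (\<lambda>i. c * a i)"
  by (simp add: cycle_def scaleR_sum_right)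

lemma cycle_zero: "cycle (\<lambda>_. 0) = 0"
  by (simp add: cycle_def)

lemma loop_in_H1_int:
  assumes "i \<in> {1..g}"
  shows "loop i \<in> H1_int \<Gamma>"
proof -
  have "loop i \<in> real_chains \<Gamma>"
    using assms by (auto simp: loop_def real_chains_def in_keys_iff lookup_add lookup_single when_def split: if_splits)
  moreover have "Poly_Mapping.lookup (loop i) e \<in> \<int>" for e
    by (auto simp: loop_def lookup_add lookup_single when_def)
  moreover have "boundary \<Gamma> (loop i) v = 0" for v
    using assms by (auto simp: loop_def boundary_add boundary_single w_vertex_def)
  ultimately show ?thesis
    by (simp add: H1_int_def H1_real_def integral_chains_def)
qed

lemma cycle_in_H1_real: "cycle a \<in> H1_real \<Gamma>"
proof -
  have "(\<Sum>i\<in>I. a i *\<^sub>R loop i) \<in> H1_real \<Gamma>" if "I \<subseteq> {1..g}" for I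
    using that
    by (induction I rule: infinite_finite_induct)
      (use loop_in_H1_int in \<open>auto simp: H1_int_def intro!: H1_real_add H1_real_scaleR\<close>)
  then show ?thesis by (simp add: cycle_def)
qed

text \<open>A cycle has total flow 0 across every cut. Suitable cuts show that it is equal on the
  two halves of a loop and 0 on bridges.\<close>

lemma H1_real_imp_cycle:
  assumes h: "h \<in> H1_real \<Gamma>"
  shows "h = cycle (\<lambda>i. Poly_Mapping.lookup h (Bottom i))"
proof (rule poly_mapping_eqI)
  have orth: "(\<Sum>e\<in>arcs \<Gamma>. Poly_Mapping.lookup h e * (pot (head \<Gamma> e) - pot (tail \<Gamma> e))) = 0" for pot
    using h by (simp add: sum_potential_differences H1_real_def)
  have outside: "Poly_Mapping.lookup h e = 0" if "e \<notin> arcs \<Gamma>" for e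
    using h that by (auto simp: H1_real_def real_chains_def in_keys_iff)
  fix e
  show "Poly_Mapping.lookup h e = Poly_Mapping.lookup (cycle (\<lambda>i. Poly_Mapping.lookup h (Bottom i))) e"
  proof (cases "e \<in> arcs \<Gamma>")
    case False
    then show ?thesis by (cases e) (auto simp: outside lookup_cycle)
  next
    case e: True
    show ?thesis
    proof (cases e)
      case (Top i)
      with e have i: "i \<in> {1..g}" "x i \<noteq> 0" by auto
      \<comment> \<open>The cut between \<open>vv i\<close> and \<open>ww i\<close>: the potential
        is 0 up to \<open>vv i\<close> and 1 from \<open>ww i\<close> on. Only \<open>Top i\<close>
        and \<open>Bottom i\<close> cross it, in opposite directions. It respects merged vertices
        because \<open>x i\<close> is not 0.\<close>
      have 1: "x j = 0 \<Longrightarrow> (if j \<ge> i then 1 else 0 :: real) = (if j > i then 1 else 0)" for j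
        using i by (cases "j = i") auto
      have 2: "b j = 0 \<Longrightarrow> (if Suc j > i then 1 else 0 :: real) = (if j \<ge> i then 1 else 0)" for j
        using i by (cases "j = i") auto
      obtain pot where pot: "\<And>j. j \<ge> 1 \<Longrightarrow> pot (vv j) = (if j > i then 1 else 0 :: real)"
        "\<And>j. j \<ge> 1 \<Longrightarrow> pot (ww j) = (if j \<ge> i then 1 else 0)"
        using vertex_function[of "\<lambda>j. if j \<ge> i then 1 else 0" "\<lambda>j. if j > i then 1 else 0", OF 1 2] by blast
      have "(\<Sum>e\<in>arcs \<Gamma>. Poly_Mapping.lookup h e * (pot (head \<Gamma> e) - pot (tail \<Gamma> e))) =
        (\<Sum>j=1..g. if j = i then Poly_Mapping.lookup h (Top i) - Poly_Mapping.lookup h (Bottom i) else 0)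
        + (\<Sum>j=1..<g. 0)"
        unfolding sum_arcs using i by (intro arg_cong2[where f = "(+)"] sum.cong) (auto simp: pot)
      with orth[of pot] i show ?thesis by (simp add: Top lookup_cycle)
    next
      case (Bottom i)
      with e show ?thesis by (simp add: lookup_cycle)
    next
      case (Bridge i)
      with e have i: "i \<in> {1..<g}" "b i \<noteq> 0" by auto
      \<comment> \<open>The cut through bridge i alone: loops up to i get 0 and later loops get 1.
        It respects merged vertices because \<open>b i\<close> is not 0.\<close>
      have 1: "x j = 0 \<Longrightarrow> (if j > i then 1 else 0 :: real) = (if j > i then 1 else 0)" for j
        using i by (cases "j = i") auto
      have 2: "b j = 0 \<Longrightarrow> (if Suc j > i then 1 else 0 :: real) = (if j > i then 1 else 0)" for j
        using i by (cases "j = i") auto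
      obtain pot where pot: "\<And>j. j \<ge> 1 \<Longrightarrow> pot (vv j) = (if j > i then 1 else 0 :: real)"
        "\<And>j. j \<ge> 1 \<Longrightarrow> pot (ww j) = (if j > i then 1 else 0)"
        using vertex_function[of "\<lambda>j. if j > i then 1 else 0" "\<lambda>j. if j > i then 1 else 0", OF 1 2] by blast
      have "(\<Sum>e\<in>arcs \<Gamma>. Poly_Mapping.lookup h e * (pot (head \<Gamma> e) - pot (tail \<Gamma> e))) =
        (\<Sum>j=1..g. 0) + (\<Sum>j=1..<g. if j = i then Poly_Mapping.lookup h (Bridge i) else 0)"
        unfolding sum_arcs using i by (intro arg_cong2[where f = "(+)"] sum.cong) (auto simp: pot)
      with orth[of pot] i show ?thesis by (simp add: Bridge lookup_cycle)
    qed
  qed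
qed

lemma H1_real_eq: "H1_real \<Gamma> = range cycle"
  using H1_real_imp_cycle cycle_in_H1_real by blast

lemma cycle_in_H1_int_iff: "cycle a \<in> H1_int \<Gamma> \<longleftrightarrow> (\<forall>i\<in>{1..g}. a i \<in> \<int>)"
proof
  assume "cycle a \<in> H1_int \<Gamma>"
  then have "Poly_Mapping.lookup (cycle a) (Bottom i) \<in> \<int>" for i
    by (simp add: H1_int_def integral_chains_def)
  then show "\<forall>i\<in>{1..g}. a i \<in> \<int>"
    by (metis lookup_cycle(2))
next
  assume a: "\<forall>i\<in>{1..g}. a i \<in> \<int>"
  have "Poly_Mapping.lookup (cycle a) e \<in> \<int>" for e
    using a by (cases e) (auto simp: lookup_cycle)
  then show "cycle a \<in> H1_int \<Gamma>"
    using cycle_in_H1_real[of a] by (simp add: H1_int_def H1_real_def integral_chains_def)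
qed

text \<open>The length pairing of c with \<open>loop i\<close>. If \<open>x i\<close> is 0, the term
  of the missing arc \<open>Top i\<close> vanishes through its factor.\<close>

definition period :: "loop_arc chain \<Rightarrow> nat \<Rightarrow> real" where
  "period c i = Poly_Mapping.lookup c (Top i) * x i + Poly_Mapping.lookup c (Bottom i) * (l i - x i)"

lemma length_form_cycle: "length_form \<Gamma> c (cycle a) = (\<Sum>i=1..g. a i * period c i)"
proof -
  have "length_form \<Gamma> c (cycle a) = (\<Sum>i=1..g. a i * period c i) + (\<Sum>i=1..<g. 0)"
    unfolding length_form_def sum_arcs
    by (intro arg_cong2[where f = "(+)"] sum.cong) (auto simp: lookup_cycle period_def algebra_simps)
  then show ?thesis by simp
qed

lemma period_cycle: "i \<in> {1..g} \<Longrightarrow> period (cycle a) i = a i * l i"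
  by (auto simp: period_def lookup_cycle algebra_simps)

text \<open>As the loops span the homology, the pairing condition has to be tested on them only, and
  distinct loops are orthogonal. So coordinate i is the i-th period of a bounding chain divided by
  \<open>l i\<close>.\<close>

lemma abel_jacobi_cycle_iff:
  "abel_jacobi \<Gamma> D (cycle a) \<longleftrightarrow> (\<exists>c. bounding_chain \<Gamma> D c \<and> (\<forall>i\<in>{1..g}. period c i = a i * l i))"
proof -
  have "(\<forall>h\<in>H1_real \<Gamma>. length_form \<Gamma> (cycle a) h = length_form \<Gamma> c h) \<longleftrightarrow>
      (\<forall>i\<in>{1..g}. period c i = a i * l i)" for c
  proof
    assume *: "\<forall>h\<in>H1_real \<Gamma>. length_form \<Gamma> (cycle a) h = length_form \<Gamma> c h"
    show "\<forall>i\<in>{1..g}. period c i = a i * l i"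
    proof
      fix i assume i: "i \<in> {1..g}"
      have "length_form \<Gamma> c' (cycle (\<lambda>j. if j = i then 1 else 0)) = period c' i" for c'
        using i by (simp add: length_form_cycle if_distrib[of "\<lambda>t. t * _"] cong: if_cong)
      then show "period c i = a i * l i"
        using bspec[OF * cycle_in_H1_real, of "\<lambda>j. if j = i then 1 else 0"] period_cycle[OF i, of a] by simp
    qed
  qed (auto simp: H1_real_eq length_form_cycle period_cycle)
  then show ?thesis
    by (simp add: abel_jacobi_def cycle_in_H1_real)
qed

text \<open>The potential is integrated along top arcs and bridges. The bottom arc of loop i then
  has the right difference because y is orthogonal to that loop.\<close>

lemma cycle_potential:
  assumes y: "\<And>h. h \<in> H1_real \<Gamma> \<Longrightarrow> (\<Sum>e\<in>arcs \<Gamma>. Poly_Mapping.lookup h e * y e) = 0"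
  shows "\<exists>pot. \<forall>e\<in>arcs \<Gamma>. pot (head \<Gamma> e) - pot (tail \<Gamma> e) = y e"
proof -
  define top where "top i = (if x i = 0 then 0 else y (Top i))" for i
  define bridge where "bridge i = (if b i = 0 then 0 else y (Bridge i))" for i
  \<comment> \<open>Arcs of length 0 contribute 0, which gives compatibility with merged vertices.
    The summand at index 0 only shifts all values at j \<ge> 1 by the same constant.\<close>
  define fv where "fv j = (\<Sum>i<j. top i + bridge i)" for j :: nat
  obtain pot where pot: "\<And>j. j \<ge> 1 \<Longrightarrow> pot (vv j) = fv j" "\<And>j. j \<ge> 1 \<Longrightarrow> pot (ww j) = fv j + top j"
  proof (rule vertex_function)
    show "x j = 0 \<Longrightarrow> fv j + top j = fv j" "b j = 0 \<Longrightarrow> fv (Suc j) = fv j + top j" for j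
      by (simp_all add: top_def bridge_def fv_def)
  qed blast
  have bottom: "y (Bottom i) = - top i" if i: "i \<in> {1..g}" for i
  proof -
    have "(\<Sum>e\<in>arcs \<Gamma>. Poly_Mapping.lookup (cycle (\<lambda>j. if j = i then 1 else 0)) e * y e) =
      (\<Sum>j=1..g. if j = i then top i + y (Bottom i) else 0) + (\<Sum>j=1..<g. 0)"
      unfolding sum_arcs by (intro arg_cong2[where f = "(+)"] sum.cong) (auto simp: lookup_cycle top_def)
    with y[OF cycle_in_H1_real] i show ?thesis by simp
  qed
  have "pot (head \<Gamma> e) - pot (tail \<Gamma> e) = y e" if "e \<in> arcs \<Gamma>" for e
    using that by (cases e) (auto simp: pot bottom top_def bridge_def fv_def)
  then show ?thesis by blast
qed

lemma principal_iff: "D \<in> divisors \<Gamma> \<Longrightarrow> D \<in> principal_divisors \<Gamma> \<longleftrightarrow> abel_jacobi \<Gamma> D 0"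
  using principal_imp_abel_jacobi_zero abel_jacobi_zero_imp_principal cycle_potential by blast

text \<open>Connectedness, as an integral path from \<open>vv 1\<close> to v. Walking v1, w1, v2,
  w2, ... uses top arcs and bridges, always forwards; merged vertices require no arc.\<close>

lemma path_chain:
  assumes "v \<in> verts \<Gamma>"
  shows "\<exists>\<gamma>\<in>integral_chains \<Gamma>. \<forall>u. boundary \<Gamma> \<gamma> u = (if v = u then 1 else 0) - (if vv 1 = u then 1 else 0)"
proof -
  let ?P = "\<lambda>v. \<exists>\<gamma>\<in>integral_chains \<Gamma>. \<forall>u. boundary \<Gamma> \<gamma> u = (if v = u then 1 else 0) - (if vv 1 = u then 1 else 0)"
  have single: "Poly_Mapping.single e 1 \<in> integral_chains \<Gamma>" if "e \<in> arcs \<Gamma>" for e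
    using that by (auto simp: integral_chains_def real_chains_def lookup_single when_def)
  have extend: "?P (head \<Gamma> e)" if e: "e \<in> arcs \<Gamma>" and "?P (tail \<Gamma> e)" for e
  proof -
    obtain \<gamma> where "\<gamma> \<in> integral_chains \<Gamma>"
      "\<forall>u. boundary \<Gamma> \<gamma> u = (if tail \<Gamma> e = u then 1 else 0) - (if vv 1 = u then 1 else 0)"
      using \<open>?P (tail \<Gamma> e)\<close> by blast
    then show ?thesis
      using single[OF e] e
      by (intro bexI[of _ "\<gamma> + Poly_Mapping.single e 1"])
        (auto simp: boundary_add boundary_single integral_chains_add)
  qed
  have vw: "?P (vv j) \<Longrightarrow> ?P (ww j)" if "j \<in> {1..g}" for j
    using extend[of "Top j"] that by (cases "x j = 0") (auto simp: w_vertex_def)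
  have v: "j \<le> g \<Longrightarrow> ?P (vv j)" if "j \<ge> 1" for j
    using that
  proof (induction j rule: dec_induct)
    case base
    show ?case by (intro bexI[of _ 0]) auto
  next
    case (step j)
    then have "?P (ww j)" using vw by auto
    with step.hyps step.prems extend[of "Bridge j"] show ?case
      by (cases "b j = 0") (auto simp: w_vertex_def v_vertex.simps(2))
  qed
  obtain j where j: "j \<in> {1..g}" "v = vv j \<or> v = ww j"
    using assms by (auto simp: verts_chain)
  then have "?P (vv j)" using v by simp
  with j vw show ?thesis by blast
qed

section \<open>Coordinates of divisors of degree 0\<close>

definition coordinates :: "(loop_mark, loop_arc) divisor \<Rightarrow> (nat \<Rightarrow> real) \<Rightarrow> bool" where
  "coordinates D a \<longleftrightarrow> abel_jacobi \<Gamma> D (cycle a)"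

lemma coordinates_add:
  "coordinates D a \<Longrightarrow> coordinates D' a' \<Longrightarrow> coordinates (D + D') (\<lambda>i. a i + a' i)"
  unfolding coordinates_def cycle_add[symmetric] by (rule abel_jacobi_add)

lemma coordinates_diff:
  "coordinates D a \<Longrightarrow> coordinates D' a' \<Longrightarrow> coordinates (D - D') (\<lambda>i. a i - a' i)"
  unfolding coordinates_def cycle_diff[symmetric] by (rule abel_jacobi_diff)

text \<open>This fixes the ambiguity of coordinates: integers at the indices in {1..g}, anything
  elsewhere. Uniqueness and change of representative follow by subtracting or adding the zero
  divisor.\<close>

lemma coordinates_zero_iff: "coordinates 0 a \<longleftrightarrow> (\<forall>i\<in>{1..g}. a i \<in> \<int>)"
  unfolding coordinates_def abel_jacobi_zero_iff cycle_in_H1_int_iff ..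

lemma coordinates_unique:
  "coordinates D a \<Longrightarrow> coordinates D a' \<Longrightarrow> i \<in> {1..g} \<Longrightarrow> a i - a' i \<in> \<int>"
  using coordinates_diff[of D a D a'] by (simp add: coordinates_zero_iff)

lemma coordinates_cong:
  assumes "coordinates D a" "\<And>i. i \<in> {1..g} \<Longrightarrow> a' i - a i \<in> \<int>"
  shows "coordinates D a'"
  using coordinates_add[OF assms(1), of 0 "\<lambda>i. a' i - a i"] assms(2)
  by (simp add: coordinates_zero_iff)

text \<open>Abel's theorem in the form used from here on: linear equivalence is equality of
  coordinates modulo integers.\<close>

lemma principal_iff_coordinates:
  assumes "D \<in> divisors \<Gamma>" "coordinates D a"
  shows "D \<in> principal_divisors \<Gamma> \<longleftrightarrow> (\<forall>i\<in>{1..g}. a i \<in> \<int>)"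
proof -
  have "D \<in> principal_divisors \<Gamma> \<longleftrightarrow> coordinates D (\<lambda>_. 0)"
    by (simp add: principal_iff assms(1) coordinates_def cycle_zero)
  also have "\<dots> \<longleftrightarrow> (\<forall>i\<in>{1..g}. a i \<in> \<int>)"
    using coordinates_unique[OF assms(2), of "\<lambda>_. 0"] coordinates_cong[OF assms(2), of "\<lambda>_. 0"]
    by (auto simp: Ints_minus)
  finally show ?thesis .
qed

lemma principal_degree_zero: "D \<in> principal_divisors \<Gamma> \<Longrightarrow> D \<in> divisors \<Gamma> \<and> degree D = 0"
  using principal_imp_abel_jacobi_zero[of D] bounding_chain_imp_degree_zero[of D]
  by (auto simp: abel_jacobi_def principal_divisors_def)

text \<open>Join \<open>vv 1\<close> to the foot of each point of D by a path, with multiplicity.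
  The contributions at \<open>vv 1\<close> cancel because the degree is 0, which leaves the integral
  part of a bounding chain.\<close>

lemma coordinates_exist:
  assumes D: "D \<in> divisors \<Gamma>" and deg: "degree D = 0"
  shows "\<exists>a. coordinates D a"
proof -
  have "\<forall>v\<in>verts \<Gamma>. \<exists>\<gamma>. \<gamma> \<in> integral_chains \<Gamma> \<and>
      (\<forall>u. boundary \<Gamma> \<gamma> u = (if v = u then 1 else 0) - (if vv 1 = u then 1 else 0))"
    using path_chain by blast
  then obtain \<gamma> where \<gamma>: "\<And>v. v \<in> verts \<Gamma> \<Longrightarrow> \<gamma> v \<in> integral_chains \<Gamma>"
    "\<And>v u. v \<in> verts \<Gamma> \<Longrightarrow> boundary \<Gamma> (\<gamma> v) u = (if v = u then 1 else 0) - (if vv 1 = u then 1 else 0)"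
    unfolding bchoice_iff by blast
  have foot: "foot \<Gamma> p \<in> verts \<Gamma>" if "p \<in> Poly_Mapping.keys D" for p
    using D that tail_in_verts by (auto simp: divisors_def points_def)
  define \<alpha> where "\<alpha> = divisor_sum (\<lambda>p. \<gamma> (foot \<Gamma> p)) D"
  have "\<alpha> \<in> integral_chains \<Gamma>"
    unfolding \<alpha>_def divisor_sum_def using \<gamma>(1) foot
    by (intro integral_chains_sum integral_chains_scaleR) auto
  moreover have "boundary \<Gamma> \<alpha> u = divisor_sum (\<lambda>p. if foot \<Gamma> p = u then 1 else 0) D" for u
  proof -
    have "boundary \<Gamma> \<alpha> u = divisor_sum (\<lambda>p. if foot \<Gamma> p = u then 1 else 0) D - divisor_sum (\<lambda>_. if vv 1 = u then 1 else 0) D"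
      unfolding \<alpha>_def divisor_sum_def boundary_sum boundary_scaleR sum_subtractf[symmetric]
      using \<gamma>(2) foot by (intro sum.cong) (auto simp: right_diff_distrib)
    also have "divisor_sum (\<lambda>_. if vv 1 = u then 1 else 0 :: real) D = (if vv 1 = u then 1 else 0) * of_int (degree D)"
      by (simp add: divisor_sum_def degree_def)
    finally show ?thesis using deg by simp
  qed
  ultimately have "bounding_chain \<Gamma> D (\<alpha> + divisor_sum (segment_chain \<Gamma>) D)"
    by (auto simp: bounding_chain_iff)
  then show ?thesis
    unfolding coordinates_def abel_jacobi_cycle_iff using len_pos
    by (intro exI[of _ "\<lambda>i. period (\<alpha> + divisor_sum (segment_chain \<Gamma>) D) i / l i"]
         exI[of _ "\<alpha> + divisor_sum (segment_chain \<Gamma>) D"]) (force dest: len_pos)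
qed

text \<open>Both points have the same foot, so the segment between them is a bounding chain with
  integral part 0. Its only possibly nonzero period is t, around the loop containing e; on a bridge
  there is none.\<close>

lemma coordinates_inner:
  assumes "e \<in> arcs \<Gamma>" "0 < t" "t < arc_len \<Gamma> e"
  shows "coordinates (frag_of (Inner e t) - frag_of (Vertex (tail \<Gamma> e)))
           (\<lambda>j. if e = Top j \<or> e = Bottom j then t / l j else 0)"
proof -
  have "bounding_chain \<Gamma> (frag_of (Inner e t) - frag_of (Vertex (tail \<Gamma> e)))
      (Poly_Mapping.single e (t / arc_len \<Gamma> e))"
    unfolding bounding_chain_iff by (intro bexI[of _ 0]) (auto simp: divisor_sum_diff)
  moreover have "period (Poly_Mapping.single e (t / arc_len \<Gamma> e)) i =
      (if e = Top i \<or> e = Bottom i then t / l i else 0) * l i" if "i \<in> {1..g}" for i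
    using assms len_pos[OF that] by (auto simp: period_def lookup_single when_def)
  ultimately show ?thesis
    unfolding coordinates_def abel_jacobi_cycle_iff by blast
qed

lemma coordinates_inner_arcs:
  shows "i \<in> {1..g} \<Longrightarrow> 0 < t \<Longrightarrow> t < x i \<Longrightarrow>
      coordinates (frag_of (Inner (Top i) t) - frag_of (Vertex (vv i))) (\<lambda>j. if j = i then t / l i else 0)"
    and "i \<in> {1..g} \<Longrightarrow> 0 < t \<Longrightarrow> t < l i - x i \<Longrightarrow>
      coordinates (frag_of (Inner (Bottom i) t) - frag_of (Vertex (ww i))) (\<lambda>j. if j = i then t / l i else 0)"
    and "i \<in> {1..<g} \<Longrightarrow> 0 < t \<Longrightarrow> t < b i \<Longrightarrow>
      coordinates (frag_of (Inner (Bridge i) t) - frag_of (Vertex (ww i))) (\<lambda>_. 0)"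
proof -
  have "(\<lambda>j. if i = j then t / l j else 0) = (\<lambda>j. if j = i then t / l i else 0)"
    by auto
  then show "i \<in> {1..g} \<Longrightarrow> 0 < t \<Longrightarrow> t < x i \<Longrightarrow>
      coordinates (frag_of (Inner (Top i) t) - frag_of (Vertex (vv i))) (\<lambda>j. if j = i then t / l i else 0)"
    "i \<in> {1..g} \<Longrightarrow> 0 < t \<Longrightarrow> t < l i - x i \<Longrightarrow>
      coordinates (frag_of (Inner (Bottom i) t) - frag_of (Vertex (ww i))) (\<lambda>j. if j = i then t / l i else 0)"
    using coordinates_inner[of "Top i" t] coordinates_inner[of "Bottom i" t] by simp_all
  show "i \<in> {1..<g} \<Longrightarrow> 0 < t \<Longrightarrow> t < b i \<Longrightarrow>
      coordinates (frag_of (Inner (Bridge i) t) - frag_of (Vertex (ww i))) (\<lambda>_. 0)"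
    using coordinates_inner[of "Bridge i" t] by simp
qed

lemma coordinates_w_minus_v:
  assumes "i \<in> {1..g}"
  shows "coordinates (frag_of (Vertex (ww i)) - frag_of (Vertex (vv i))) (\<lambda>j. if j = i then x i / l i else 0)"
proof (cases "x i = 0")
  case True
  then show ?thesis by (simp add: w_vertex_def coordinates_zero_iff)
next
  case False
  have "bounding_chain \<Gamma> (frag_of (Vertex (ww i)) - frag_of (Vertex (vv i))) (Poly_Mapping.single (Top i) 1)"
    unfolding bounding_chain_iff using assms False
    by (intro bexI[of _ "Poly_Mapping.single (Top i) 1"])
      (auto simp: divisor_sum_diff boundary_single integral_chains_def real_chains_def lookup_single when_def)
  moreover have "period (Poly_Mapping.single (Top i) 1) j = (if j = i then x i / l i else 0) * l j" if "j \<in> {1..g}" for j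
    using len_pos[OF that] by (auto simp: period_def lookup_single when_def)
  ultimately show ?thesis
    unfolding coordinates_def abel_jacobi_cycle_iff by blast
qed

lemma vertex_in_points: "i \<in> {1..g} \<Longrightarrow> Vertex (vv i) \<in> points \<Gamma>" "i \<in> {1..g} \<Longrightarrow> Vertex (ww i) \<in> points \<Gamma>"
  by (auto simp: points_def verts_chain)

text \<open>A point is compared with the origin of its own loop. A bridge segment has no periods, so
  a point of bridge i has the coordinates of \<open>ww i\<close> and is assigned to loop i.\<close>

lemma coordinates_point:
  assumes "p \<in> points \<Gamma>"
  shows "\<exists>i\<in>{1..g}. \<exists>s. coordinates (frag_of p - frag_of (Vertex (vv i))) (\<lambda>j. if j = i then s else 0)"
proof -
  have w: "\<exists>s. coordinates (frag_of p - frag_of (Vertex (vv i))) (\<lambda>j. if j = i then s else 0)"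
    if "i \<in> {1..g}" "coordinates (frag_of p - frag_of (Vertex (ww i))) (\<lambda>j. if j = i then s else 0)" for i s
  proof -
    have "(\<lambda>j. (if j = i then s else 0) + (if j = i then x i / l i else 0)) = (\<lambda>j. if j = i then s + x i / l i else 0)"
      by auto
    with coordinates_add[OF that(2) coordinates_w_minus_v[OF that(1)]] show ?thesis
      by auto
  qed
  show ?thesis
  proof (cases p)
    case (Vertex v)
    with assms consider i where "i \<in> {1..g}" "v = vv i" | i where "i \<in> {1..g}" "v = ww i"
      by (auto simp: points_def verts_chain)
    then show ?thesis
    proof cases
      case 1
      then show ?thesis
        by (intro bexI[of _ i] exI[of _ 0]) (auto simp: Vertex coordinates_zero_iff)
    next
      case 2
      then show ?thesis
        using w[of i 0] by (auto simp: Vertex coordinates_zero_iff)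
    qed
  next
    case (Inner e t)
    with assms have e: "e \<in> arcs \<Gamma>" "0 < t" "t < arc_len \<Gamma> e" by (auto simp: points_def)
    show ?thesis
    proof (cases e)
      case (Top i)
      with e coordinates_inner_arcs(1)[of i t] show ?thesis
        by (auto simp: Inner)
    next
      case (Bottom i)
      with e have i: "i \<in> {1..g}" by simp
      from Bottom e coordinates_inner_arcs(2)[OF i, of t] show ?thesis
        using w[OF i, of "t / l i"] i by (auto simp: Inner)
    next
      case (Bridge i)
      with e have i: "i \<in> {1..g}" by simp
      from Bridge e coordinates_inner_arcs(3)[of i t] show ?thesis
        using w[OF i, of 0] i by (auto simp: Inner)
    qed
  qed
qed

text \<open>Coordinate s is realised at distance \<open>frac s * l i\<close> from
  \<open>vv i\<close>, measured first along the top arc and then along the bottom arc.\<close>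

lemma point_with_coordinates:
  assumes i: "i \<in> {1..g}"
  shows "\<exists>p\<in>points \<Gamma>. coordinates (frag_of p - frag_of (Vertex (vv i))) (\<lambda>j. if j = i then s else 0)"
proof -
  define t where "t = frac s * l i"
  have l: "0 < l i" "0 \<le> x i" "x i < l i" using len_pos[OF i] marked_points[OF i] by auto
  have t: "0 \<le> t" "t < l i"
    using l frac_ge_0[of s] frac_lt_1[of s] by (auto simp: t_def)
  have "\<exists>p\<in>points \<Gamma>. coordinates (frag_of p - frag_of (Vertex (vv i))) (\<lambda>j. if j = i then t / l i else 0)"
  proof -
    consider "t = 0" | "0 < t" "t < x i" | "t = x i" | "x i < t" using t by linarith
    then show ?thesis
    proof cases
      case 1
      then show ?thesis
        using vertex_in_points[OF i] by (intro bexI[of _ "Vertex (vv i)"]) (auto simp: coordinates_zero_iff)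
    next
      case 2
      then show ?thesis
        using i l coordinates_inner_arcs(1)[OF i]
        by (intro bexI[of _ "Inner (Top i) t"]) (auto simp: points_def)
    next
      case 3
      then show ?thesis
        using vertex_in_points[OF i] coordinates_w_minus_v[OF i] by auto
    next
      case 4
      have "coordinates (frag_of (Inner (Bottom i) (t - x i)) - frag_of (Vertex (ww i)))
          (\<lambda>j. if j = i then (t - x i) / l i else 0)"
        using l t 4 by (intro coordinates_inner_arcs(2)[OF i]) auto
      from coordinates_add[OF this coordinates_w_minus_v[OF i]]
      have "coordinates (frag_of (Inner (Bottom i) (t - x i)) - frag_of (Vertex (vv i)))
          (\<lambda>j. (if j = i then (t - x i) / l i else 0) + (if j = i then x i / l i else 0))"
        by simp
      also have "(\<lambda>j. (if j = i then (t - x i) / l i else 0) + (if j = i then x i / l i else 0)) =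
          (\<lambda>j. if j = i then t / l i else 0)"
        using l by (auto simp: diff_divide_distrib)
      finally show ?thesis
        using i l t 4 by (intro bexI[of _ "Inner (Bottom i) (t - x i)"]) (auto simp: points_def)
    qed
  qed
  then obtain p where p: "p \<in> points \<Gamma>"
    "coordinates (frag_of p - frag_of (Vertex (vv i))) (\<lambda>j. if j = i then t / l i else 0)" by blast
  have "coordinates (frag_of p - frag_of (Vertex (vv i))) (\<lambda>j. if j = i then s else 0)"
    by (rule coordinates_cong[OF p(2)]) (use l in \<open>auto simp: t_def frac_def\<close>)
  with p(1) show ?thesis by blast
qed

end

section \<open>Finite unions of cosets of coordinate subtori\<close>

text \<open>
  Subsets of the torus with coordinates indexed by \<open>I\<close> are represented by their preimages in \<open>\<real>\<^sup>I\<close>;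
  the coset of the subtorus with the free coordinates \<open>S\<close> fixes the coordinates outside \<open>S\<close> modulo \<open>\<int>\<close>.
\<close>

definition torus_coset :: "'i set \<Rightarrow> ('i \<Rightarrow> real) \<Rightarrow> 'i set \<Rightarrow> ('i \<Rightarrow> real) set" where
  "torus_coset I a S = {a'. \<forall>i\<in>I - S. a' i - a i \<in> \<int>}"

definition coset_union :: "'i set \<Rightarrow> ('i \<Rightarrow> real) set \<Rightarrow> bool" where
  "coset_union I X \<longleftrightarrow> (\<exists>F. finite F \<and> X = (\<Union>(a, S)\<in>F. torus_coset I a S))"

text \<open>Once two cosets share a point, inclusion is a matter of free coordinates. Indices of S
  outside I do not matter, hence the intersection with I.\<close>

lemma torus_coset_subset:
  assumes "c \<in> torus_coset I a S" "c \<in> torus_coset I a' S'" "S \<inter> I \<subseteq> S'"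
  shows "torus_coset I a S \<subseteq> torus_coset I a' S'"
proof
  fix u assume u: "u \<in> torus_coset I a S"
  have "u i - a' i \<in> \<int>" if "i \<in> I - S'" for i
  proof -
    have "u i - a i \<in> \<int>" "c i - a i \<in> \<int>" "c i - a' i \<in> \<int>"
      using that u assms by (auto simp: torus_coset_def)
    from Ints_add[OF Ints_diff[OF this(1,2)] this(3)] show ?thesis by simp
  qed
  then show "u \<in> torus_coset I a' S'" by (simp add: torus_coset_def)
qed

lemma torus_coset_self [simp]: "a \<in> torus_coset I a S"
  by (simp add: torus_coset_def)

text \<open>Both cosets can be rebased at the common point c, and then only the coordinates free in
  both remain free.\<close>

lemma torus_coset_Int:
  assumes "c \<in> torus_coset I a S" "c \<in> torus_coset I a' S'"
  shows "torus_coset I a S \<inter> torus_coset I a' S' = torus_coset I c (S \<inter> S')"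
proof -
  have eq: "torus_coset I a S = torus_coset I c S" "torus_coset I a' S' = torus_coset I c S'"
    using assms torus_coset_subset[of c I a S c S] torus_coset_subset[of c I c S a S]
      torus_coset_subset[of c I a' S' c S'] torus_coset_subset[of c I c S' a' S'] by auto
  show ?thesis unfolding eq by (auto simp: torus_coset_def)
qed

lemma coset_union_torus_coset: "coset_union I (torus_coset I a S)"
  unfolding coset_union_def by (intro exI[of _ "{(a, S)}"]) auto

lemma coset_union_empty: "coset_union I {}"
  unfolding coset_union_def by (intro exI[of _ "{}"]) auto

lemma coset_union_Un:
  assumes "coset_union I X" "coset_union I Y"
  shows "coset_union I (X \<union> Y)"
proof -
  obtain F G where "finite F" "X = (\<Union>(a, S)\<in>F. torus_coset I a S)"
    "finite G" "Y = (\<Union>(a, S)\<in>G. torus_coset I a S)"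
    using assms by (auto simp: coset_union_def)
  then show ?thesis
    unfolding coset_union_def by (intro exI[of _ "F \<union> G"]) auto
qed

lemma coset_union_UN:
  "finite J \<Longrightarrow> (\<And>j. j \<in> J \<Longrightarrow> coset_union I (X j)) \<Longrightarrow> coset_union I (\<Union>j\<in>J. X j)"
  by (induction J rule: finite_induct) (auto intro: coset_union_empty coset_union_Un)

lemma coset_union_torus_coset_Int_Inter:
  assumes "finite I" "\<And>C. C \<in> \<F> \<Longrightarrow> coset_union I C"
  shows "coset_union I (torus_coset I a S \<inter> \<Inter>\<F>)"
proof (induction "card (S \<inter> I)" arbitrary: a S rule: less_induct)
  case less
  show ?case
  proof (cases "torus_coset I a S \<subseteq> \<Inter>\<F>")
    case True
    then show ?thesis by (simp add: Int_absorb2 coset_union_torus_coset)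
  next
    case False
    then obtain C where C: "C \<in> \<F>" "\<not> torus_coset I a S \<subseteq> C" by auto
    then obtain F where F: "finite F" "C = (\<Union>(a, S)\<in>F. torus_coset I a S)"
      using assms(2) by (auto simp: coset_union_def)
    have "coset_union I (torus_coset I a S \<inter> torus_coset I a' S' \<inter> \<Inter>\<F>)" if "(a', S') \<in> F" for a' S'
    proof (cases "torus_coset I a S \<inter> torus_coset I a' S' = {}")
      case True
      then show ?thesis by (simp add: coset_union_empty)
    next
      case False
      then obtain c where c: "c \<in> torus_coset I a S" "c \<in> torus_coset I a' S'" by auto
      \<comment> \<open>Otherwise the coset of S would lie in that of S' and hence in C. So every
        piece cut out by C loses a free coordinate, and the induction hypothesis applies to
        it.\<close>
      have "\<not> S \<inter> I \<subseteq> S'"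
        using torus_coset_subset[OF c] C(2) that F(2) by blast
      then have "card (S \<inter> S' \<inter> I) < card (S \<inter> I)"
        using assms(1) by (intro psubset_card_mono) auto
      then show ?thesis
        using less.hyps[of "S \<inter> S'" c] by (simp add: torus_coset_Int[OF c])
    qed
    then have "coset_union I (\<Union>(a', S')\<in>F. torus_coset I a S \<inter> torus_coset I a' S' \<inter> \<Inter>\<F>)"
      using F(1) by (intro coset_union_UN) auto
    also have "(\<Union>(a', S')\<in>F. torus_coset I a S \<inter> torus_coset I a' S' \<inter> \<Inter>\<F>) = torus_coset I a S \<inter> \<Inter>\<F>"
      using C(1) F(2) by auto
    finally show ?thesis .
  qed
qed

lemma coset_union_UNIV: "coset_union I UNIV"
  using coset_union_torus_coset[of I undefined I] by (simp add: torus_coset_def)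

lemma coset_union_Inter:
  assumes "finite I" "\<And>C. C \<in> \<F> \<Longrightarrow> coset_union I C"
  shows "coset_union I (\<Inter>\<F>)"
  \<comment> \<open>With all coordinates in I free the coset is the whole space, whatever its base
    point.\<close>
  using coset_union_torus_coset_Int_Inter[OF assms, of _ undefined I] by (simp add: torus_coset_def)

lemma coset_union_translate:
  assumes "coset_union I X"
  shows "coset_union I {a. (\<lambda>i. a i - t i) \<in> X}"
proof -
  obtain F where F: "finite F" "X = (\<Union>(a, S)\<in>F. torus_coset I a S)"
    using assms by (auto simp: coset_union_def)
  have "{a. (\<lambda>i. a i - t i) \<in> X} = (\<Union>(a, S)\<in>F. torus_coset I (\<lambda>i. a i + t i) S)"
  proof -
    have "(\<lambda>i. c i - t i) \<in> torus_coset I a S \<longleftrightarrow> c \<in> torus_coset I (\<lambda>i. a i + t i) S" for c a S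
      by (simp add: torus_coset_def diff_diff_eq add.commute)
    then show ?thesis unfolding F(2) by (simp add: set_eq_iff case_prod_unfold)
  qed
  also have "coset_union I \<dots>"
    using F(1) by (intro coset_union_UN) (auto intro: coset_union_torus_coset)
  finally show ?thesis .
qed

lemma torus_coset_sum:
  "{\<lambda>i. u i + v i | u v. u \<in> torus_coset I a S \<and> v \<in> torus_coset I a' S'} =
     torus_coset I (\<lambda>i. a i + a' i) (S \<union> S')" (is "?L = ?R")
proof
  have "(u i + v i) - (a i + a' i) \<in> \<int>" if "u i - a i \<in> \<int>" "v i - a' i \<in> \<int>" for u v i
    using Ints_add[OF that] by (simp add: algebra_simps)
  then show "?L \<subseteq> ?R" by (force simp: torus_coset_def)
next
  show "?R \<subseteq> ?L"
  proof
    fix c assume c: "c \<in> ?R"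
    \<comment> \<open>On S the second summand is made equal to \<open>a'\<close> and u absorbs the
      rest; outside S the first summand is a and the second takes the rest, which is constrained
      only where neither coset is free.\<close>
    define u where "u i = (if i \<in> S then c i - a' i else a i)" for i
    have "u \<in> torus_coset I a S"
      by (simp add: torus_coset_def u_def)
    moreover have "(\<lambda>i. c i - u i) \<in> torus_coset I a' S'"
      using c by (auto simp: torus_coset_def u_def diff_diff_eq)
    ultimately show "c \<in> ?L"
      by (intro CollectI exI[of _ u] exI[of _ "\<lambda>i. c i - u i"]) auto
  qed
qed

lemma coset_union_sum:
  assumes "coset_union I X" "coset_union I Y"
  shows "coset_union I {\<lambda>i. u i + v i | u v. u \<in> X \<and> v \<in> Y}"
proof -
  obtain F G where F: "finite F" "X = (\<Union>(a, S)\<in>F. torus_coset I a S)"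
    and G: "finite G" "Y = (\<Union>(a, S)\<in>G. torus_coset I a S)"
    using assms by (auto simp: coset_union_def)
  have "{\<lambda>i. u i + v i | u v. u \<in> X \<and> v \<in> Y} = (\<Union>(a, S)\<in>F. \<Union>(a', S')\<in>G.
      {\<lambda>i. u i + v i | u v. u \<in> torus_coset I a S \<and> v \<in> torus_coset I a' S'})"
    unfolding F(2) G(2) by fast
  also have "\<dots> = (\<Union>(a, S)\<in>F. \<Union>(a', S')\<in>G. torus_coset I (\<lambda>i. a i + a' i) (S \<union> S'))"
    by (simp add: torus_coset_sum)
  also have "coset_union I \<dots>"
    using F(1) G(1) by (intro coset_union_UN) (auto intro!: coset_union_UN coset_union_torus_coset)
  finally show ?thesis .
qed

section \<open>The rank in coordinates\<close>

lemma effective_add: "effective D \<Longrightarrow> effective D' \<Longrightarrow> effective (D + D')"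
  by (simp add: effective_def lookup_add)

lemma effective_frag_of [simp]: "effective (frag_of p)"
  by (simp add: effective_def)

lemma effective_frag_cmul: "c \<ge> 0 \<Longrightarrow> effective D \<Longrightarrow> effective (frag_cmul c D)"
  by (simp add: effective_def)

lemma effective_degree_nonneg: "effective D \<Longrightarrow> degree D \<ge> 0"
  by (simp add: effective_def degree_def sum_nonneg)

lemma effective_degree_zero:
  assumes "effective D" "degree D = 0"
  shows "D = 0"
proof -
  have "\<forall>p\<in>Poly_Mapping.keys D. Poly_Mapping.lookup D p = 0"
    using assms by (subst (asm) degree_def, subst (asm) sum_nonneg_eq_0_iff) (auto simp: effective_def)
  then show ?thesis
    by (intro poly_mapping_eqI) (auto simp: in_keys_iff)
qed

lemma effective_split:
  assumes "effective D" "degree D > 0" "D \<in> divisors \<Gamma>"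
  obtains p where "p \<in> points \<Gamma>" "effective (D - frag_of p)"
proof -
  have "Poly_Mapping.keys D \<noteq> {}"
    using assms(2) by (auto simp: degree_def)
  then obtain p where p: "p \<in> Poly_Mapping.keys D" by blast
  then have "Poly_Mapping.lookup D p > 0"
    using assms(1) by (simp add: effective_def in_keys_iff order.not_eq_order_implies_strict)
  then have "effective (D - frag_of p)"
    using assms(1) by (auto simp: effective_def lookup_minus)
  moreover have "p \<in> points \<Gamma>"
    using p assms(3) by (auto simp: divisors_def)
  ultimately show thesis by (rule that[rotated])
qed

context loop_chain
begin

section \<open>Linear equivalence and the rank, tested by effective divisors\<close>

abbreviation base :: "(loop_mark, loop_arc) point" where
  "base \<equiv> Vertex (ww g)"

lemma base_in_points [simp]: "base \<in> points \<Gamma>"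
  using genus by (intro vertex_in_points) auto

lemma base_divisor [simp]: "frag_cmul c (frag_of base) \<in> divisors \<Gamma>"
  by (intro frag_cmul_divisors) simp

lemma degree_base [simp]: "degree (frag_cmul c (frag_of base)) = c"
  by (simp add: degree_frag_cmul)

lemma principal_zero: "0 \<in> principal_divisors \<Gamma>"
  by (simp add: principal_iff_coordinates[of _ "\<lambda>_. 0"] coordinates_zero_iff)

lemma principal_diff:
  assumes "D \<in> principal_divisors \<Gamma>" "D' \<in> principal_divisors \<Gamma>"
  shows "D - D' \<in> principal_divisors \<Gamma>"
  using abel_jacobi_diff[OF assms[THEN principal_imp_abel_jacobi_zero]] assms[THEN principal_degree_zero]
  by (simp add: principal_iff diff_divisors)

lemma equiv_to_effective_degree_nonneg:
  assumes "equiv_to_effective \<Gamma> D"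
  shows "degree D \<ge> 0"
proof -
  obtain D' where "effective D'" "D - D' \<in> principal_divisors \<Gamma>"
    using assms by (auto simp: equiv_to_effective_def linearly_equivalent_def)
  then show ?thesis
    using principal_degree_zero[of "D - D'"] effective_degree_nonneg[of D'] by (simp add: degree_diff)
qed

lemma equiv_to_effective_add:
  assumes "equiv_to_effective \<Gamma> D" "E \<in> divisors \<Gamma>" "effective E"
  shows "equiv_to_effective \<Gamma> (D + E)"
proof -
  obtain D' where "D' \<in> divisors \<Gamma>" "effective D'" "D - D' \<in> principal_divisors \<Gamma>"
    using assms(1) by (auto simp: equiv_to_effective_def linearly_equivalent_def)
  with assms(2,3) show ?thesis
    unfolding equiv_to_effective_def linearly_equivalent_def
    by (intro bexI[of _ "D' + E"]) (auto intro: effective_add add_divisors)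
qed

text \<open>Needed to evaluate \<open>GREATEST\<close>: the admissible k are bounded by the degree
  (test with k times the base point) and downward closed (enlarge E by the base point, then give it
  back).\<close>

lemma divisor_rank_ge_iff:
  assumes D: "D \<in> divisors \<Gamma>" and r: "r \<ge> 0"
  shows "r \<le> divisor_rank \<Gamma> D \<longleftrightarrow>
    (\<forall>E\<in>divisors \<Gamma>. effective E \<and> degree E = r \<longrightarrow> equiv_to_effective \<Gamma> (D - E))"
proof -
  define P where "P k \<longleftrightarrow> (\<forall>E\<in>divisors \<Gamma>. effective E \<and> degree E = int k \<longrightarrow> equiv_to_effective \<Gamma> (D - E))" for k
  have bound: "k \<le> nat (degree D)" if "P k" for k
  proof -
    have "equiv_to_effective \<Gamma> (D - frag_cmul (int k) (frag_of base))"
      using that by (auto simp: P_def effective_frag_cmul)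
    from equiv_to_effective_degree_nonneg[OF this] show ?thesis
      by (simp add: degree_diff)
  qed
  have down: "P k" if "P (Suc k)" for k
    unfolding P_def
  proof (intro ballI impI)
    fix E assume E: "E \<in> divisors \<Gamma>" "effective E \<and> degree E = int k"
    then have "E + frag_of base \<in> divisors \<Gamma>" "effective (E + frag_of base)" "degree (E + frag_of base) = int (Suc k)"
      by (simp_all add: degree_add add_divisors effective_add)
    then have "equiv_to_effective \<Gamma> (D - (E + frag_of base))"
      using that unfolding P_def by blast
    from equiv_to_effective_add[OF this, of "frag_of base"] show "equiv_to_effective \<Gamma> (D - E)"
      by (simp add: algebra_simps)
  qed
  have antimono: "P j" if "P k" "j \<le> k" for j k
    using that(2,1) by (induction rule: inc_induct) (auto intro: down)
  have P0: "P 0 \<longleftrightarrow> equiv_to_effective \<Gamma> D"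
  proof
    assume "P 0"
    then show "equiv_to_effective \<Gamma> D"
      unfolding P_def by (auto simp: effective_def dest: bspec[of _ _ 0])
  qed (auto simp: P_def dest: effective_degree_zero)
  have rank: "divisor_rank \<Gamma> D = (if P 0 then int (GREATEST k. P k) else - 1)"
    unfolding divisor_rank_def P0 unfolding P_def ..
  have "r \<le> divisor_rank \<Gamma> D \<longleftrightarrow> P (nat r)"
  proof
    assume *: "r \<le> divisor_rank \<Gamma> D"
    with r rank have "P 0" by (auto split: if_splits)
    then have "P (GREATEST k. P k)"
      by (rule GreatestI_nat) (rule bound)
    moreover have "nat r \<le> (GREATEST k. P k)"
      using * rank \<open>P 0\<close> by simp
    ultimately show "P (nat r)" by (rule antimono)
  next
    assume P: "P (nat r)"
    then have "nat r \<le> (GREATEST k. P k)"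
      by (rule Greatest_le_nat) (rule bound)
    moreover have "P 0" using P by (rule antimono) simp
    ultimately show "r \<le> divisor_rank \<Gamma> D" using r by (simp add: rank)
  qed
  then show ?thesis using r by (simp add: P_def)
qed

text \<open>Coordinates exist in degree 0 only, so degree d is shifted by d times the base point, as
  in the Brill-Noether locus.\<close>

definition effective_coordinates :: "int \<Rightarrow> (nat \<Rightarrow> real) set" where
  "effective_coordinates d = {a. \<exists>P\<in>divisors \<Gamma>. effective P \<and> degree P = d \<and>
     coordinates (P - frag_cmul d (frag_of base)) a}"

lemma equiv_to_effective_iff:
  assumes D: "D \<in> divisors \<Gamma>" "degree D = d" and a: "coordinates (D - frag_cmul d (frag_of base)) a"
  shows "equiv_to_effective \<Gamma> D \<longleftrightarrow> a \<in> effective_coordinates d"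
proof
  assume "equiv_to_effective \<Gamma> D"
  then obtain P where P: "P \<in> divisors \<Gamma>" "effective P" "D - P \<in> principal_divisors \<Gamma>"
    by (auto simp: equiv_to_effective_def linearly_equivalent_def)
  then have deg: "degree P = d"
    using principal_degree_zero[of "D - P"] D by (simp add: degree_diff)
  have "coordinates (D - P) (\<lambda>_. 0)"
    using P(3) by (simp add: coordinates_def cycle_zero principal_imp_abel_jacobi_zero)
  from coordinates_diff[OF a this] have "coordinates (P - frag_cmul d (frag_of base)) a"
    by (simp add: algebra_simps del: minus_frag_cmul)
  with P deg show "a \<in> effective_coordinates d"
    unfolding effective_coordinates_def by blast
next
  assume "a \<in> effective_coordinates d"
  then obtain P where P: "P \<in> divisors \<Gamma>" "effective P" "coordinates (P - frag_cmul d (frag_of base)) a"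
    by (auto simp: effective_coordinates_def)
  from coordinates_diff[OF a this(3)] have "D - P \<in> principal_divisors \<Gamma>"
    using D P by (simp add: principal_iff_coordinates[of "D - P" "\<lambda>_. 0"] diff_divisors)
  with P show "equiv_to_effective \<Gamma> D"
    by (auto simp: equiv_to_effective_def linearly_equivalent_def)
qed

text \<open>The Abel-Jacobi image of the graph: for each loop i a circle in direction i through the
  class of \<open>vv i\<close>, with each bridge collapsed to a point.\<close>

lemma coset_union_point_coordinates:
  "coset_union {1..g} {a. \<exists>p\<in>points \<Gamma>. coordinates (frag_of p - frag_of base) a}"
proof -
  have "\<exists>a. coordinates (frag_of (Vertex (vv i)) - frag_of base) a" if "i \<in> {1..g}" for i
    using vertex_in_points[OF that] by (intro coordinates_exist diff_divisors) (auto simp: degree_diff)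
  then obtain c where c: "\<And>i. i \<in> {1..g} \<Longrightarrow> coordinates (frag_of (Vertex (vv i)) - frag_of base) (c i)"
    by metis
  have "{a. \<exists>p\<in>points \<Gamma>. coordinates (frag_of p - frag_of base) a} = (\<Union>i\<in>{1..g}. torus_coset {1..g} (c i) {i})"
  proof (intro equalityI subsetI)
    fix a assume "a \<in> {a. \<exists>p\<in>points \<Gamma>. coordinates (frag_of p - frag_of base) a}"
    then obtain p where p: "p \<in> points \<Gamma>" "coordinates (frag_of p - frag_of base) a" by blast
    obtain i s where i: "i \<in> {1..g}" "coordinates (frag_of p - frag_of (Vertex (vv i))) (\<lambda>j. if j = i then s else 0)"
      using coordinates_point[OF p(1)] by blast
    have "coordinates (frag_of p - frag_of base) (\<lambda>j. (if j = i then s else 0) + c i j)"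
      using coordinates_add[OF i(2) c[OF i(1)]] by simp
    note diff = coordinates_unique[OF p(2) this]
    have "a j - c i j \<in> \<int>" if "j \<in> {1..g} - {i}" for j
      using diff[of j] that by simp
    then have "a \<in> torus_coset {1..g} (c i) {i}"
      by (simp add: torus_coset_def)
    then show "a \<in> (\<Union>i\<in>{1..g}. torus_coset {1..g} (c i) {i})" by (rule UN_I[OF i(1)])
  next
    fix a assume "a \<in> (\<Union>i\<in>{1..g}. torus_coset {1..g} (c i) {i})"
    then obtain i where i: "i \<in> {1..g}" "a \<in> torus_coset {1..g} (c i) {i}" by blast
    obtain p where p: "p \<in> points \<Gamma>"
      "coordinates (frag_of p - frag_of (Vertex (vv i))) (\<lambda>j. if j = i then a i - c i i else 0)"
      using point_with_coordinates[OF i(1)] by blast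
    have "coordinates (frag_of p - frag_of base) (\<lambda>j. (if j = i then a i - c i i else 0) + c i j)"
      using coordinates_add[OF p(2) c[OF i(1)]] by simp
    then have "coordinates (frag_of p - frag_of base) a"
      by (rule coordinates_cong) (use i(2) in \<open>auto simp: torus_coset_def\<close>)
    with p(1) show "a \<in> {a. \<exists>p\<in>points \<Gamma>. coordinates (frag_of p - frag_of base) a}" by blast
  qed
  also have "coset_union {1..g} \<dots>"
    by (intro coset_union_UN coset_union_torus_coset) simp
  finally show ?thesis .
qed

lemma effective_coordinates_Suc:
  "effective_coordinates (int (Suc n)) =
     {\<lambda>i. u i + v i | u v. u \<in> effective_coordinates (int n) \<and>
        v \<in> {a. \<exists>p\<in>points \<Gamma>. coordinates (frag_of p - frag_of base) a}}" (is "?L = ?R")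
proof (intro equalityI subsetI)
  have w: "frag_cmul (int (Suc n)) (frag_of base) = frag_cmul (int n) (frag_of base) + frag_of base"
    using frag_cmul_distrib[of "int n" 1 "frag_of base"] by (simp add: add.commute)
  {
    fix a assume "a \<in> ?L"
    then obtain P where P: "P \<in> divisors \<Gamma>" "effective P" "degree P = int (Suc n)"
      "coordinates (P - frag_cmul (int (Suc n)) (frag_of base)) a"
      unfolding effective_coordinates_def by blast
    obtain p where p: "p \<in> points \<Gamma>" "effective (P - frag_of p)"
      using effective_split[of P \<Gamma>] P by auto
    have deg: "degree (P - frag_of p) = int n" and div: "P - frag_of p \<in> divisors \<Gamma>"
      using P p by (simp_all add: degree_diff diff_divisors)
    \<comment> \<open>Coordinates u are chosen for the divisor with p removed; a - u then represents
      p exactly, with no correction by integers.\<close>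
    have "\<exists>u. coordinates (P - frag_of p - frag_cmul (int n) (frag_of base)) u"
      using div deg by (intro coordinates_exist) (simp_all add: degree_diff diff_divisors del: minus_frag_cmul)
    then obtain u where u: "coordinates (P - frag_of p - frag_cmul (int n) (frag_of base)) u" ..
    have "coordinates (frag_of p - frag_of base) (\<lambda>i. a i - u i)"
      using coordinates_diff[OF P(4) u] unfolding w by (simp add: algebra_simps)
    moreover have "u \<in> effective_coordinates (int n)"
      using u p div deg unfolding effective_coordinates_def by blast
    ultimately show "a \<in> ?R"
      using p(1) by (intro CollectI exI[of _ u] exI[of _ "\<lambda>i. a i - u i"]) auto
  next
    fix a assume "a \<in> ?R"
    then obtain u v P p where a: "a = (\<lambda>i. u i + v i)"
      and P: "P \<in> divisors \<Gamma>" "effective P" "degree P = int n"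
      "coordinates (P - frag_cmul (int n) (frag_of base)) u"
      and p: "p \<in> points \<Gamma>" "coordinates (frag_of p - frag_of base) v"
      unfolding effective_coordinates_def by blast
    have "coordinates (P + frag_of p - frag_cmul (int (Suc n)) (frag_of base)) a"
      using coordinates_add[OF P(4) p(2)] unfolding w a by (simp add: algebra_simps)
    moreover have "P + frag_of p \<in> divisors \<Gamma>" "effective (P + frag_of p)" "degree (P + frag_of p) = int (Suc n)"
      using P p(1) by (simp_all add: add_divisors effective_add degree_add)
    ultimately show "a \<in> ?L"
      unfolding effective_coordinates_def by blast
  }
qed

lemma coset_union_effective_coordinates: "coset_union {1..g} (effective_coordinates d)"
proof (cases "d < 0")
  case True
  then have "effective_coordinates d = {}"
    using effective_degree_nonneg by (force simp: effective_coordinates_def)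
  then show ?thesis by (simp add: coset_union_empty)
next
  case False
  have "coset_union {1..g} (effective_coordinates (int n))" for n
  proof (induction n)
    case 0
    \<comment> \<open>The zero divisor is the only one, so its coordinates form the lattice, the
      coset without free coordinates.\<close>
    have "effective_coordinates (int 0) = torus_coset {1..g} (\<lambda>_. 0) {}"
    proof (intro equalityI subsetI)
      fix a assume "a \<in> effective_coordinates (int 0)"
      then have "coordinates 0 a"
        using effective_degree_zero by (auto simp: effective_coordinates_def)
      then show "a \<in> torus_coset {1..g} (\<lambda>_. 0) {}"
        by (simp add: torus_coset_def coordinates_zero_iff)
    next
      fix a assume "a \<in> torus_coset {1..g} (\<lambda>_. 0) {}"
      then have "coordinates 0 a"
        by (simp add: torus_coset_def coordinates_zero_iff)
      then show "a \<in> effective_coordinates (int 0)"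
        unfolding effective_coordinates_def by (intro CollectI bexI[of _ 0]) (auto simp: effective_def)
    qed
    then show ?case by (simp add: coset_union_torus_coset)
  next
    case (Suc n)
    then show ?case
      unfolding effective_coordinates_Suc using coset_union_point_coordinates by (rule coset_union_sum)
  qed
  from this[of "nat d"] False show ?thesis by simp
qed

lemma rank_locus_coset_union:
  obtains X where "coset_union {1..g} X"
    "\<And>D a. D \<in> divisors \<Gamma> \<Longrightarrow> degree D = 0 \<Longrightarrow> coordinates D a \<Longrightarrow>
       r \<le> divisor_rank \<Gamma> (D + frag_cmul d (frag_of base)) \<longleftrightarrow> a \<in> X"
proof (cases "r < 0")
  case True
  \<comment> \<open>The rank is never below -1.\<close>
  have "r \<le> divisor_rank \<Gamma> D" for D
    using True by (auto simp: divisor_rank_def)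
  then show thesis by (intro that[of UNIV] coset_union_UNIV) simp
next
  case False
  define \<E> where "\<E> = {E \<in> divisors \<Gamma>. effective E \<and> degree E = r}"
  have "\<exists>e. coordinates (E - frag_cmul r (frag_of base)) e" if "E \<in> \<E>" for E
    using that by (intro coordinates_exist) (auto simp: \<E>_def degree_diff diff_divisors simp del: minus_frag_cmul)
  then obtain e where e: "\<And>E. E \<in> \<E> \<Longrightarrow> coordinates (E - frag_cmul r (frag_of base)) (e E)"
    by metis
  \<comment> \<open>If D has coordinates a, then \<open>a - e E\<close> belongs to D + d * base - E,
    shifted by d - r times the base point. X demands effectivity for every E of degree r.\<close>
  define X where "X = \<Inter>((\<lambda>E. {a. (\<lambda>i. a i - e E i) \<in> effective_coordinates (d - r)}) ` \<E>)"
  show thesis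
  proof (rule that[of X])
    show "coset_union {1..g} X"
      using coset_union_translate[OF coset_union_effective_coordinates]
      unfolding X_def by (intro coset_union_Inter) blast+
    fix D a assume D: "D \<in> divisors \<Gamma>" "degree D = 0" "coordinates D a"
    let ?D = "D + frag_cmul d (frag_of base)"
    have "equiv_to_effective \<Gamma> (?D - E) \<longleftrightarrow> (\<lambda>i. a i - e E i) \<in> effective_coordinates (d - r)" if "E \<in> \<E>" for E
    proof (rule equiv_to_effective_iff)
      show "?D - E \<in> divisors \<Gamma>" "degree (?D - E) = d - r"
        using D that by (simp_all add: \<E>_def add_divisors diff_divisors degree_add degree_diff)
      have eq: "?D - E - frag_cmul (d - r) (frag_of base) = D - (E - frag_cmul r (frag_of base))"
        unfolding frag_cmul_diff_distrib by simp
      show "coordinates (?D - E - frag_cmul (d - r) (frag_of base)) (\<lambda>i. a i - e E i)"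
        unfolding eq using D(3) e[OF that] by (rule coordinates_diff)
    qed
    then show "r \<le> divisor_rank \<Gamma> ?D \<longleftrightarrow> a \<in> X"
      using D(1) False by (simp add: divisor_rank_ge_iff add_divisors X_def) (auto simp: \<E>_def)
  qed
qed

end

section \<open>Tropical abelian subvarieties of the Jacobian\<close>

lemma carrier_degree_zero_group:
  "D \<in> carrier (degree_zero_group \<Gamma>) \<longleftrightarrow> D \<in> divisors \<Gamma> \<and> degree D = 0"
  by (simp add: degree_zero_group_def)

lemma degree_zero_group_simps [simp]:
  "x \<otimes>\<^bsub>degree_zero_group \<Gamma>\<^esub> y = x + y" "\<one>\<^bsub>degree_zero_group \<Gamma>\<^esub> = 0"
  by (simp_all add: degree_zero_group_def free_Abelian_group_def)

lemma comm_group_degree_zero_group: "comm_group (degree_zero_group \<Gamma>)"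
proof (rule comm_groupI)
  fix D assume "D \<in> carrier (degree_zero_group \<Gamma>)"
  \<comment> \<open>The inverse is written as a difference, so that the facts on differences of
    divisors apply.\<close>
  then have "0 - D \<in> carrier (degree_zero_group \<Gamma>)"
    unfolding carrier_degree_zero_group by (simp add: degree_diff diff_divisors del: diff_0)
  then show "\<exists>E\<in>carrier (degree_zero_group \<Gamma>). E \<otimes>\<^bsub>degree_zero_group \<Gamma>\<^esub> D = \<one>\<^bsub>degree_zero_group \<Gamma>\<^esub>"
    by (intro bexI[of _ "0 - D"]) simp
qed (auto simp: carrier_degree_zero_group degree_add add_divisors add_ac)

context loop_chain
begin

lemma normal_principal: "principal_divisors \<Gamma> \<lhd> degree_zero_group \<Gamma>"
proof -
  interpret comm_group "degree_zero_group \<Gamma>" by (rule comm_group_degree_zero_group)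
  have sub: "principal_divisors \<Gamma> \<subseteq> carrier (degree_zero_group \<Gamma>)"
    using principal_degree_zero by (auto simp: carrier_degree_zero_group)
  have neg: "- D \<in> principal_divisors \<Gamma>" if "D \<in> principal_divisors \<Gamma>" for D
    using principal_diff[OF principal_zero that] by simp
  have "subgroup (principal_divisors \<Gamma>) (degree_zero_group \<Gamma>)"
  proof (rule subgroupI[OF sub])
    show "principal_divisors \<Gamma> \<noteq> {}" using principal_zero by blast
    fix D assume D: "D \<in> principal_divisors \<Gamma>"
    then have "inv\<^bsub>degree_zero_group \<Gamma>\<^esub> D = - D"
      using sub neg[OF D] by (intro inv_equality) auto
    then show "inv\<^bsub>degree_zero_group \<Gamma>\<^esub> D \<in> principal_divisors \<Gamma>"
      using neg[OF D] by simp
    fix D' assume "D' \<in> principal_divisors \<Gamma>"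
    then show "D \<otimes>\<^bsub>degree_zero_group \<Gamma>\<^esub> D' \<in> principal_divisors \<Gamma>"
      using principal_diff[OF D neg] by simp
  qed
  then show ?thesis by (rule subgroup_imp_normal)
qed

lemma group_Jac: "group (Jac \<Gamma>)"
  unfolding Jac_def by (rule normal.factorgroup_is_group[OF normal_principal])

lemma carrier_Jac: "carrier (Jac \<Gamma>) = divisor_class \<Gamma> ` carrier (degree_zero_group \<Gamma>)"
  by (auto simp: Jac_def FactGroup_def RCOSETS_def divisor_class_def)

lemma mult_divisor_class:
  assumes "D \<in> carrier (degree_zero_group \<Gamma>)" "D' \<in> carrier (degree_zero_group \<Gamma>)"
  shows "divisor_class \<Gamma> D \<otimes>\<^bsub>Jac \<Gamma>\<^esub> divisor_class \<Gamma> D' = divisor_class \<Gamma> (D + D')"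
  using normal.rcos_sum[OF normal_principal assms] by (simp add: Jac_def FactGroup_def divisor_class_def)

section \<open>Cosets of coordinate subtori as sets of divisor classes\<close>

definition coset_classes :: "(nat \<Rightarrow> real) \<Rightarrow> nat set \<Rightarrow> (loop_mark, loop_arc) divisor set set" where
  "coset_classes a S = {divisor_class \<Gamma> D | D. D \<in> carrier (degree_zero_group \<Gamma>) \<and>
     (\<exists>a'\<in>torus_coset {1..g} a S. coordinates D a')}"

text \<open>Outside S the coordinates vanish exactly and not merely modulo integers, because the
  representative must lie in a linear subspace of the homology.\<close>

definition subtorus :: "nat set \<Rightarrow> (loop_mark, loop_arc) divisor set set" where
  "subtorus S = {divisor_class \<Gamma> D | D. D \<in> carrier (degree_zero_group \<Gamma>) \<and>
     (\<exists>a. (\<forall>i\<in>{1..g} - S. a i = 0) \<and> coordinates D a)}"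

lemma subtorus_subset: "subtorus S \<subseteq> carrier (Jac \<Gamma>)"
  by (auto simp: subtorus_def carrier_Jac)

text \<open>The subspace is spanned by the loops with index in S. These are lattice vectors, so the
  lattice in it has full rank.\<close>

lemma tropical_abelian_subvariety_subtorus: "tropical_abelian_subvariety \<Gamma> (subtorus S)"
proof -
  define V where "V = cycle ` {a. \<forall>i\<in>{1..g} - S. a i = 0}"
  have "0 \<in> V"
    unfolding V_def by (rule image_eqI[of _ _ "\<lambda>_. 0"]) (simp_all add: cycle_zero)
  moreover have "u + v \<in> V" "c *\<^sub>R u \<in> V" if "u \<in> V" "v \<in> V" for u v c
    using that by (auto simp: V_def cycle_add cycle_scaleR)
  ultimately have V: "subspace V"
    by (auto intro: subspaceI)
  have "cycle a \<in> span (H1_int \<Gamma> \<inter> V)" if a: "\<forall>i\<in>{1..g} - S. a i = 0" for a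
    unfolding cycle_def
  proof (rule span_sum)
    fix i assume i: "i \<in> {1..g}"
    show "a i *\<^sub>R loop i \<in> span (H1_int \<Gamma> \<inter> V)"
    proof (cases "i \<in> S")
      case True
      have "loop i = cycle (\<lambda>j. if j = i then 1 else 0)"
        using i by (simp add: cycle_def if_distrib[of "\<lambda>t. t *\<^sub>R _"] cong: if_cong)
      then have "loop i \<in> V"
        using True by (auto simp: V_def)
      with loop_in_H1_int[OF i] show ?thesis
        by (intro span_scale span_base) simp
    next
      case False
      with a i show ?thesis by (simp add: span_zero)
    qed
  qed
  then have "V \<subseteq> span (H1_int \<Gamma> \<inter> V)" by (auto simp: V_def)
  moreover have "span (H1_int \<Gamma> \<inter> V) \<subseteq> V"
    using V by (intro span_minimal) auto
  ultimately have "span (H1_int \<Gamma> \<inter> V) = V" by blast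
  moreover have "V \<subseteq> H1_real \<Gamma>"
    by (auto simp: V_def cycle_in_H1_real)
  moreover have "subtorus S = {divisor_class \<Gamma> D | D. D \<in> carrier (degree_zero_group \<Gamma>) \<and>
      (\<exists>v\<in>V. abel_jacobi \<Gamma> D v)}"
    unfolding subtorus_def coordinates_def V_def by blast
  ultimately show ?thesis
    unfolding tropical_abelian_subvariety_def using V by blast
qed

text \<open>Any class of the coset can serve as its base point; later this will be a class in
  H.\<close>

lemma translate_subtorus:
  assumes "\<gamma> \<in> coset_classes a S"
  shows "\<gamma> <#\<^bsub>Jac \<Gamma>\<^esub> subtorus S = coset_classes a S"
proof (intro equalityI subsetI)
  obtain D\<^sub>0 a\<^sub>0 where \<gamma>: "\<gamma> = divisor_class \<Gamma> D\<^sub>0"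
    and D\<^sub>0: "D\<^sub>0 \<in> carrier (degree_zero_group \<Gamma>)" "coordinates D\<^sub>0 a\<^sub>0" and a\<^sub>0: "a\<^sub>0 \<in> torus_coset {1..g} a S"
    using assms by (auto simp: coset_classes_def)
  {
    fix \<beta> assume "\<beta> \<in> \<gamma> <#\<^bsub>Jac \<Gamma>\<^esub> subtorus S"
    then obtain D a' where D: "D \<in> carrier (degree_zero_group \<Gamma>)" "coordinates D a'"
      and a': "\<forall>i\<in>{1..g} - S. a' i = 0" and \<beta>: "\<beta> = \<gamma> \<otimes>\<^bsub>Jac \<Gamma>\<^esub> divisor_class \<Gamma> D"
      by (auto simp: l_coset_def subtorus_def)
    have "(\<lambda>i. a\<^sub>0 i + a' i) \<in> torus_coset {1..g} a S"
      using a\<^sub>0 a' by (simp add: torus_coset_def)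
    moreover have "\<beta> = divisor_class \<Gamma> (D\<^sub>0 + D)"
      by (simp add: \<beta> \<gamma> mult_divisor_class D D\<^sub>0)
    moreover have "D\<^sub>0 + D \<in> carrier (degree_zero_group \<Gamma>)"
      using D D\<^sub>0 by (simp add: carrier_degree_zero_group degree_add add_divisors)
    ultimately show "\<beta> \<in> coset_classes a S"
      using coordinates_add[OF D\<^sub>0(2) D(2)] unfolding coset_classes_def by blast
  next
    fix \<beta> assume "\<beta> \<in> coset_classes a S"
    then obtain D a' where D: "D \<in> carrier (degree_zero_group \<Gamma>)" "coordinates D a'"
      and a': "a' \<in> torus_coset {1..g} a S" and \<beta>: "\<beta> = divisor_class \<Gamma> D"
      by (auto simp: coset_classes_def)
    \<comment> \<open>Outside S the difference of the two representatives is an integer and may be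
      replaced by 0, which puts the difference of the classes into the subtorus.\<close>
    define c where "c i = (if i \<in> {1..g} - S then 0 else a' i - a\<^sub>0 i)" for i
    have c_zero: "\<forall>i\<in>{1..g} - S. c i = 0" by (simp add: c_def)
    have int: "a\<^sub>0 i - a' i \<in> \<int>" if "i \<in> {1..g} - S" for i
      using Ints_diff[of "a\<^sub>0 i - a i" "a' i - a i"] a\<^sub>0 a' that by (simp add: torus_coset_def)
    have "coordinates (D - D\<^sub>0) c"
      by (rule coordinates_cong[OF coordinates_diff[OF D(2) D\<^sub>0(2)]]) (use int in \<open>auto simp: c_def\<close>)
    moreover have D': "D - D\<^sub>0 \<in> carrier (degree_zero_group \<Gamma>)"
      using D D\<^sub>0 by (simp add: carrier_degree_zero_group degree_diff diff_divisors)
    ultimately have "divisor_class \<Gamma> (D - D\<^sub>0) \<in> subtorus S"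
      using c_zero unfolding subtorus_def by blast
    moreover have "\<beta> = \<gamma> \<otimes>\<^bsub>Jac \<Gamma>\<^esub> divisor_class \<Gamma> (D - D\<^sub>0)"
      using mult_divisor_class[OF D\<^sub>0(1) D'] by (simp add: \<beta> \<gamma>)
    ultimately show "\<beta> \<in> \<gamma> <#\<^bsub>Jac \<Gamma>\<^esub> subtorus S"
      by (auto simp: l_coset_def)
  }
qed

lemma brill_noether_locus_cosets:
  obtains F where "finite F"
    "brill_noether_locus \<Gamma> base r d = (\<Union>(a, S)\<in>F. coset_classes a S)"
proof -
  obtain X where "coset_union {1..g} X"
    and X: "\<And>D a. D \<in> divisors \<Gamma> \<Longrightarrow> degree D = 0 \<Longrightarrow> coordinates D a \<Longrightarrow>
       r \<le> divisor_rank \<Gamma> (D + frag_cmul d (frag_of base)) \<longleftrightarrow> a \<in> X"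
    using rank_locus_coset_union[of r d] by blast
  then obtain F where F: "finite F" "X = (\<Union>(a, S)\<in>F. torus_coset {1..g} a S)"
    by (auto simp: coset_union_def)
  have "brill_noether_locus \<Gamma> base r d =
      {divisor_class \<Gamma> D | D. D \<in> carrier (degree_zero_group \<Gamma>) \<and> (\<exists>a\<in>X. coordinates D a)}"
    unfolding brill_noether_locus_def using X coordinates_exist
    by (fastforce simp: carrier_degree_zero_group)
  also have "\<dots> = (\<Union>(a, S)\<in>F. coset_classes a S)"
    unfolding F(2) coset_classes_def by fast
  finally show thesis using F(1) by (intro that)
qed

text \<open>Cosets that miss H are discarded and the others are rebased inside H. For such a base
  point, intersecting the coset with H is the same as translating the intersection of the subtorus
  with H.\<close>

theorem brill_noether_locus_Int_subgroup:
  assumes H: "subgroup H (Jac \<Gamma>)"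
  shows "\<exists>(s::nat) A \<gamma>.
           (\<forall>i\<in>{1..s}. tropical_abelian_subvariety \<Gamma> (A i) \<and> \<gamma> i \<in> H) \<and>
           (\<forall>i\<in>{1..s}. \<gamma> i <#\<^bsub>Jac \<Gamma>\<^esub> A i \<subseteq> brill_noether_locus \<Gamma> base r d) \<and>
           brill_noether_locus \<Gamma> base r d \<inter> H = (\<Union>i\<in>{1..s}. \<gamma> i <#\<^bsub>Jac \<Gamma>\<^esub> (A i \<inter> H))"
proof -
  interpret Jac: group "Jac \<Gamma>" by (rule group_Jac)
  obtain F where F: "finite F" and W: "brill_noether_locus \<Gamma> base r d = (\<Union>f\<in>F. coset_classes (fst f) (snd f))"
    using brill_noether_locus_cosets[of r d] by (auto simp: case_prod_unfold)
  define F' where "F' = {f \<in> F. coset_classes (fst f) (snd f) \<inter> H \<noteq> {}}"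
  have "\<forall>f\<in>F'. \<exists>\<gamma>. \<gamma> \<in> coset_classes (fst f) (snd f) \<inter> H"
    by (auto simp: F'_def)
  then obtain \<gamma> where \<gamma>: "\<And>f. f \<in> F' \<Longrightarrow> \<gamma> f \<in> coset_classes (fst f) (snd f)" "\<And>f. f \<in> F' \<Longrightarrow> \<gamma> f \<in> H"
    unfolding bchoice_iff by blast
  have coset: "\<gamma> f <#\<^bsub>Jac \<Gamma>\<^esub> subtorus (snd f) = coset_classes (fst f) (snd f)" if "f \<in> F'" for f
    by (rule translate_subtorus[OF \<gamma>(1)[OF that]])
  \<comment> \<open>The inverse of \<open>\<gamma> f\<close> also lies in H, and multiplying by it
    recovers h.\<close>
  have mem_H: "\<gamma> f \<otimes>\<^bsub>Jac \<Gamma>\<^esub> h \<in> H \<longleftrightarrow> h \<in> H" if "f \<in> F'" "h \<in> carrier (Jac \<Gamma>)" for f h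
  proof
    assume "\<gamma> f \<otimes>\<^bsub>Jac \<Gamma>\<^esub> h \<in> H"
    from subgroup.m_closed[OF H subgroup.m_inv_closed[OF H \<gamma>(2)[OF that(1)]] this]
    show "h \<in> H"
      using that(2) subgroup.mem_carrier[OF H \<gamma>(2)[OF that(1)]] by (simp flip: Jac.m_assoc)
  next
    assume "h \<in> H"
    then show "\<gamma> f \<otimes>\<^bsub>Jac \<Gamma>\<^esub> h \<in> H"
      by (rule subgroup.m_closed[OF H \<gamma>(2)[OF that(1)]])
  qed
  have "coset_classes (fst f) (snd f) \<inter> H = \<gamma> f <#\<^bsub>Jac \<Gamma>\<^esub> (subtorus (snd f) \<inter> H)" if f: "f \<in> F'" for f
  proof -
    have "\<gamma> f \<otimes>\<^bsub>Jac \<Gamma>\<^esub> h \<in> H \<longleftrightarrow> h \<in> H" if "h \<in> subtorus (snd f)" for h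
      using mem_H[OF f] subtorus_subset that by blast
    then show ?thesis
      unfolding coset[OF f, symmetric] l_coset_def by auto
  qed
  moreover have "brill_noether_locus \<Gamma> base r d \<inter> H = (\<Union>f\<in>F'. coset_classes (fst f) (snd f) \<inter> H)"
    unfolding W F'_def by blast
  ultimately have W_H: "brill_noether_locus \<Gamma> base r d \<inter> H = (\<Union>f\<in>F'. \<gamma> f <#\<^bsub>Jac \<Gamma>\<^esub> (subtorus (snd f) \<inter> H))"
    by simp
  have sub: "\<gamma> f <#\<^bsub>Jac \<Gamma>\<^esub> subtorus (snd f) \<subseteq> brill_noether_locus \<Gamma> base r d" if "f \<in> F'" for f
    using that unfolding coset[OF that] W F'_def by blast
  have "finite F'" using F by (simp add: F'_def)
  then obtain h where "bij_betw h {1..card F'} F'"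
    using ex_bij_betw_nat_finite_1 by blast
  then have img: "h ` {1..card F'} = F'" by (rule bij_betw_imp_surj_on)
  have hF: "h i \<in> F'" if "i \<in> {1..card F'}" for i
    using that img by blast
  show ?thesis
  proof (intro exI conjI ballI)
    fix i assume "i \<in> {1..card F'}"
    from hF[OF this] show "tropical_abelian_subvariety \<Gamma> (subtorus (snd (h i)))" "\<gamma> (h i) \<in> H"
      "\<gamma> (h i) <#\<^bsub>Jac \<Gamma>\<^esub> subtorus (snd (h i)) \<subseteq> brill_noether_locus \<Gamma> base r d"
      by (simp_all add: tropical_abelian_subvariety_subtorus \<gamma> sub)
  next
    show "brill_noether_locus \<Gamma> base r d \<inter> H =
        (\<Union>i\<in>{1..card F'}. \<gamma> (h i) <#\<^bsub>Jac \<Gamma>\<^esub> (subtorus (snd (h i)) \<inter> H))"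
      unfolding W_H by (subst (1) img[symmetric]) (simp only: image_image)
  qed
qed

end

theorem theorem4:
  fixes g :: nat and l x b :: "nat \<Rightarrow> real"
    and \<Gamma> :: "(loop_mark, loop_arc) metric_graph"
    and w :: "(loop_mark, loop_arc) point"
    and H :: "(loop_mark, loop_arc) divisor set set"
    and r d :: int
  assumes genus: "g \<ge> 1"
    and loop_lengths: "\<And>i. i \<in> {1..g} \<Longrightarrow> l i > 0"
    and marked_points: "\<And>i. i \<in> {1..g} \<Longrightarrow> 0 \<le> x i \<and> x i < l i"
    and bridge_lengths: "\<And>i. i \<in> {1..<g} \<Longrightarrow> b i \<ge> 0"
    and chain: "\<Gamma> = chain_of_loops g l x b"
    and base_point: "w = Vertex (w_vertex x b g)"
    and subgroup_H: "subgroup H (Jac \<Gamma>)"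
    and nonempty: "brill_noether_locus \<Gamma> w r d \<inter> H \<noteq> {}"
  shows "\<exists>(s::nat) A \<gamma>.
           (\<forall>i\<in>{1..s}. tropical_abelian_subvariety \<Gamma> (A i) \<and> \<gamma> i \<in> H) \<and>
           (\<forall>i\<in>{1..s}. \<gamma> i <#\<^bsub>Jac \<Gamma>\<^esub> A i \<subseteq> brill_noether_locus \<Gamma> w r d) \<and>
           brill_noether_locus \<Gamma> w r d \<inter> H = (\<Union>i\<in>{1..s}. \<gamma> i <#\<^bsub>Jac \<Gamma>\<^esub> (A i \<inter> H))"
proof -
  interpret loop_chain g l x b
    using genus marked_points bridge_lengths by unfold_locales
  show ?thesis
    using brill_noether_locus_Int_subgroup subgroup_H unfolding chain base_point by blast
qed

end
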